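(* Let $\mathcal{M}=(M,g)$ be a pseudo-Riemannian manifold of dimension $m\ge 2$ and let $k\ge 0$ be an integer. The following three conditions are equivalent: (1) Given any two points $P,Q\in M$, there is a linear homothety $\Phi=\Phi_{P,Q}:T_PM\to T_QM$ so that $\Phi^*(\nabla^\ell\mathfrak{R}_Q)=\nabla^\ell\mathfrak{R}_P$ for all $0\le\ell\le k$. (2) Given any two points $P,Q\in M$, there exist a linear isometry $\phi=\phi_{P,Q}:T_PM\to T_QM$ and a real number $\lambda=\lambda_{P,Q}\ne0$ so that $\phi^*(\nabla^\ell R_Q)=\lambda^{-\ell-2}\,\nabla^\ell R_P$ for all $0\le\ell\le k$. (3) There exist constants $\varepsilon_{ij}$ and constants $c_{i_1\dots i_{\ell+4}}$ (for $0\le \ell\le k$, all indices between $1$ and $m$) such that for every $Q\in M$ there are a basis $\{\xi_1^Q,\dots,\xi_m^Q\}$ of $T_QM$ and a real number $\lambda_Q\neq 0$ so that for all $0\le\ell\le k$ and all indices $i_1,i_2,\dots$ one has $g_Q(\xi^Q_{i_1},\xi^Q_{i_2})=\varepsilon_{i_1i_2}$ and $$\nabla^\ell R_Q(\xi^Q_{i_1},\xi^Q_{i_2},\xi^Q_{i_3},\xi^Q_{i_4};\xi^Q_{i_5},\dots,\xi^Q_{i_{\ell+4}})=\lambda_Q^{-\ell-2}c_{i_1\dots i_{\ell+4}}.$$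
   Context: $\nabla^\ell R\in\otimes^{\ell+4}T^*M$ is the $\ell$-th covariant derivative of the curvature tensor and $\nabla^\ell\mathfrak{R}\in\otimes^{\ell+2}T^*M\otimes\operatorname{End}(TM)$ is the $\ell$-th covariant derivative of the curvature operator; they are related by $$\nabla^\ell R(x_1,x_2,x_3,x_4;x_5,\dots,x_{\ell+4})=g(\nabla^\ell\mathfrak{R}(x_1,x_2;x_5,\dots,x_{\ell+4})x_3,x_4).$$ A linear homothety $\Phi:T_PM\to T_QM$ is a linear isomorphism with $g_Q(\Phi x,\Phi y)=\lambda^2 g_P(x,y)$ for all $x,y$ and some real $\lambda\neq0$. The condition $\Phi^*(\nabla^\ell\mathfrak{R}_Q)=\nabla^\ell\mathfrak{R}_P$ means $\Phi\{\nabla^\ell\mathfrak{R}_P(x_1,x_2;x_5,\dots,x_{\ell+4})x_3\}=\nabla^\ell\mathfrak{R}_Q(\Phi x_1,\Phi x_2;\Phi x_5,\dots,\Phi x_{\ell+4})\Phi x_3$ for all $x_i\in T_PM$. (If any of the three conditions holds, $\mathcal{M}$ is called homothety $k$-curvature homogeneous.) *)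

theory Defs
  imports "HOL-Analysis.Analysis" "HOL-Library.Function_Algebras"
begin

section \<open>Pointwise vector space structure on functions\<close>

instantiation "fun" :: (type, real_vector) real_vector
begin

definition scaleR_fun :: "real \<Rightarrow> ('a \<Rightarrow> 'b) \<Rightarrow> 'a \<Rightarrow> 'b"
  where "scaleR_fun a f = (\<lambda>x. a *\<^sub>R f x)"

instance
  by standard (simp_all add: scaleR_fun_def plus_fun_def scaleR_add_right scaleR_add_left)

end

section \<open>Smooth functions on open subsets of \<open>\<real>\<^sup>m\<close>\<close>

definition partial :: "'m::finite \<Rightarrow> (real^'m \<Rightarrow> 'b::real_normed_vector) \<Rightarrow> real^'m \<Rightarrow> 'b"
  where "partial i f x = frechet_derivative f (at x) (axis i 1)"

text \<open>For open \<open>S\<close> these are the usual classes \<open>C\<^sup>k\<close>.\<close>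

primrec Ck_on :: "nat \<Rightarrow> (real^'m::finite) set \<Rightarrow> (real^'m \<Rightarrow> 'b::real_normed_vector) \<Rightarrow> bool"
where
  "Ck_on 0 S f \<longleftrightarrow> continuous_on S f"
| "Ck_on (Suc k) S f \<longleftrightarrow> f differentiable_on S \<and> (\<forall>i. Ck_on k S (partial i f))"

definition smooth_on :: "(real^'m::finite) set \<Rightarrow> (real^'m \<Rightarrow> 'b::real_normed_vector) \<Rightarrow> bool"
  where "smooth_on S f \<longleftrightarrow> (\<forall>k. Ck_on k S f)"

section \<open>Smooth manifolds\<close>

text \<open>A chart is a pair of its domain and its coordinate map; the coordinate map is irrelevant
  outside the domain.\<close>

type_synonym ('a, 'e) chart = "'a set \<times> ('a \<Rightarrow> 'e)"

definition chart_inv :: "('a, 'e) chart \<Rightarrow> 'e \<Rightarrow> 'a"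
  where "chart_inv c = inv_into (fst c) (snd c)"

definition transition :: "('a, 'e) chart \<Rightarrow> ('a, 'e) chart \<Rightarrow> 'e \<Rightarrow> 'e"
  where "transition c c' = snd c' \<circ> chart_inv c"

definition smooth_atlas :: "'a topology \<Rightarrow> ('a, real^'m::finite) chart set \<Rightarrow> bool"
where
  "smooth_atlas M A \<longleftrightarrow>
     (\<forall>c\<in>A. openin M (fst c) \<and> open (snd c ` fst c) \<and>
        homeomorphic_map (subtopology M (fst c)) (top_of_set (snd c ` fst c)) (snd c)) \<and>
     (\<Union>c\<in>A. fst c) = topspace M \<and>
     (\<forall>c\<in>A. \<forall>c'\<in>A. smooth_on (snd c ` (fst c \<inter> fst c')) (transition c c'))"

definition smooth_manifold :: "'a topology \<Rightarrow> ('a, real^'m::finite) chart set \<Rightarrow> bool"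
where
  "smooth_manifold M A \<longleftrightarrow> Hausdorff_space M \<and> second_countable M \<and> smooth_atlas M A"

definition charts_at :: "('a, 'e) chart set \<Rightarrow> 'a \<Rightarrow> ('a, 'e) chart set"
  where "charts_at A p = {c \<in> A. p \<in> fst c}"

text \<open>A tangent vector at \<open>p\<close> is the family of its coordinate vectors with respect to all charts
  around \<open>p\<close>, related by the differentials of the transition maps. The value \<open>0\<close> at all other
  charts is a convention that makes equality of tangent vectors the equality of functions.\<close>

type_synonym ('a, 'e) tvec = "('a, 'e) chart \<Rightarrow> 'e"

definition tangent_space ::
  "('a, real^'m::finite) chart set \<Rightarrow> 'a \<Rightarrow> ('a, real^'m) tvec set"
where
  "tangent_space A p =
     {v. (\<forall>c. c \<notin> charts_at A p \<longrightarrow> v c = 0) \<and>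
         (\<forall>c\<in>charts_at A p. \<forall>c'\<in>charts_at A p.
            v c' = frechet_derivative (transition c c') (at (snd c p)) (v c))}"

text \<open>The tangent vector at \<open>p\<close> with coordinate vector \<open>w\<close> in the chart \<open>c\<close>.\<close>

definition tvec_of ::
  "('a, real^'m::finite) chart set \<Rightarrow> 'a \<Rightarrow> ('a, real^'m) chart \<Rightarrow> real^'m \<Rightarrow> ('a, real^'m) tvec"
where
  "tvec_of A p c w =
     (\<lambda>c'. if c' \<in> charts_at A p
           then frechet_derivative (transition c c') (at (snd c p)) w else 0)"

section \<open>Pseudo-Riemannian metrics\<close>

type_synonym ('a, 'e) metric_field = "'a \<Rightarrow> ('a, 'e) tvec \<Rightarrow> ('a, 'e) tvec \<Rightarrow> real"

definition metric_coords ::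
  "('a, real^'m::finite) chart set \<Rightarrow> ('a, real^'m) metric_field \<Rightarrow> ('a, real^'m) chart
    \<Rightarrow> real^'m \<Rightarrow> real^'m^'m"
where
  "metric_coords A g c y =
     (\<chi> i j. g (chart_inv c y) (tvec_of A (chart_inv c y) c (axis i 1))
                               (tvec_of A (chart_inv c y) c (axis j 1)))"

definition pseudo_riemannian_metric ::
  "'a topology \<Rightarrow> ('a, real^'m::finite) chart set \<Rightarrow> ('a, real^'m) metric_field \<Rightarrow> bool"
where
  "pseudo_riemannian_metric M A g \<longleftrightarrow>
     (\<forall>p\<in>topspace M.
        (\<forall>x\<in>tangent_space A p. \<forall>y\<in>tangent_space A p. g p x y = g p y x) \<and>
        (\<forall>x\<in>tangent_space A p. \<forall>y\<in>tangent_space A p. \<forall>z\<in>tangent_space A p.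
           g p (x + y) z = g p x z + g p y z) \<and>
        (\<forall>a. \<forall>x\<in>tangent_space A p. \<forall>z\<in>tangent_space A p. g p (a *\<^sub>R x) z = a * g p x z) \<and>
        (\<forall>x\<in>tangent_space A p. (\<forall>y\<in>tangent_space A p. g p x y = 0) \<longrightarrow> x = 0)) \<and>
     (\<forall>c\<in>A. smooth_on (snd c ` fst c) (metric_coords A g c))"

definition pseudo_riemannian_manifold ::
  "'a topology \<Rightarrow> ('a, real^'m::finite) chart set \<Rightarrow> ('a, real^'m) metric_field \<Rightarrow> bool"
where
  "pseudo_riemannian_manifold M A g \<longleftrightarrow>
     smooth_manifold M A \<and> pseudo_riemannian_metric M A g"

section \<open>Levi-Civita connection and curvature in coordinates\<close>

text \<open>\<open>christoffel G k i j\<close> is \<open>\<Gamma>\<^sup>k\<^sub>i\<^sub>j\<close>, that is, \<open>\<nabla>\<^bsub>\<partial>i\<^esub> \<partial>j = (\<Sum>k. \<Gamma>\<^sup>k\<^sub>i\<^sub>j \<partial>k)\<close>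
  for the Levi-Civita connection of the metric with matrix \<open>G\<close>.\<close>

definition christoffel ::
  "(real^'m \<Rightarrow> real^'m^'m) \<Rightarrow> 'm::finite \<Rightarrow> 'm \<Rightarrow> 'm \<Rightarrow> real^'m \<Rightarrow> real"
where
  "christoffel G k i j x =
     (1/2) * (\<Sum>l\<in>UNIV. matrix_inv (G x) $ k $ l *
        (partial i (\<lambda>y. G y $ j $ l) x + partial j (\<lambda>y. G y $ i $ l) x
         - partial l (\<lambda>y. G y $ i $ j) x))"

text \<open>Components of a covariant tensor field are indexed by the list of its lower indices.
  For an endomorphism-valued tensor field \<open>T\<close>, the component \<open>T js k l\<close> is the coefficient of
  \<open>\<partial>l\<close> in \<open>T(\<partial>j\<^sub>1, \<partial>j\<^sub>2, \<dots>) \<partial>k\<close>.\<close>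

type_synonym 'm cov_comps = "'m list \<Rightarrow> real^'m \<Rightarrow> real"
type_synonym 'm end_comps = "'m list \<Rightarrow> 'm \<Rightarrow> 'm \<Rightarrow> real^'m \<Rightarrow> real"

text \<open>The curvature operator \<open>\<RR>(X,Y) = \<nabla>\<^sub>X \<nabla>\<^sub>Y - \<nabla>\<^sub>Y \<nabla>\<^sub>X - \<nabla>\<^bsub>[X,Y]\<^esub>\<close>.\<close>

definition curv_op_comps :: "(real^'m \<Rightarrow> real^'m^'m) \<Rightarrow> 'm::finite end_comps"
where
  "curv_op_comps G js k l x =
     (let i = js ! 0; j = js ! 1; \<Gamma> = christoffel G in
      partial i (\<Gamma> l j k) x - partial j (\<Gamma> l i k) x
      + (\<Sum>a\<in>UNIV. \<Gamma> a j k x * \<Gamma> l i a x - \<Gamma> a i k x * \<Gamma> l j a x))"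

text \<open>The curvature tensor \<open>R(x\<^sub>1,x\<^sub>2,x\<^sub>3,x\<^sub>4) = g(\<RR>(x\<^sub>1,x\<^sub>2) x\<^sub>3, x\<^sub>4)\<close>.\<close>

definition curv_comps :: "(real^'m \<Rightarrow> real^'m^'m) \<Rightarrow> 'm::finite cov_comps"
where
  "curv_comps G js x =
     (\<Sum>a\<in>UNIV. curv_op_comps G [js ! 0, js ! 1] (js ! 2) a x * G x $ a $ (js ! 3))"

text \<open>Covariant differentiation; the index of the direction of differentiation is appended at
  the end: \<open>(\<nabla>T)(x\<^sub>1, \<dots>, x\<^sub>r, x\<^sub>r\<^sub>+\<^sub>1)\<close> is \<open>(\<nabla>\<^bsub>x(r+1)\<^esub> T)(x\<^sub>1, \<dots>, x\<^sub>r)\<close>.\<close>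

definition cov_deriv ::
  "(real^'m \<Rightarrow> real^'m^'m) \<Rightarrow> 'm::finite cov_comps \<Rightarrow> 'm cov_comps"
where
  "cov_deriv G T js x =
     (let ks = butlast js; j = last js; \<Gamma> = christoffel G in
      partial j (T ks) x
      - (\<Sum>n<length ks. \<Sum>a\<in>UNIV. \<Gamma> a j (ks ! n) x * T (ks[n := a]) x))"

definition cov_deriv_end ::
  "(real^'m \<Rightarrow> real^'m^'m) \<Rightarrow> 'm::finite end_comps \<Rightarrow> 'm end_comps"
where
  "cov_deriv_end G T js k l x =
     (let ks = butlast js; j = last js; \<Gamma> = christoffel G in
      partial j (T ks k l) x
      - (\<Sum>n<length ks. \<Sum>a\<in>UNIV. \<Gamma> a j (ks ! n) x * T (ks[n := a]) k l x)
      - (\<Sum>a\<in>UNIV. \<Gamma> a j k x * T ks a l x)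
      + (\<Sum>a\<in>UNIV. \<Gamma> l j a x * T ks k a x))"

section \<open>Covariant derivatives of the curvature at a point\<close>

text \<open>The values below are computed in a chart around \<open>p\<close>. All the objects are tensors, so they
  do not depend on the choice of the chart.\<close>

definition chart_at :: "('a, 'e) chart set \<Rightarrow> 'a \<Rightarrow> ('a, 'e) chart"
  where "chart_at A p = (SOME c. c \<in> charts_at A p)"

text \<open>\<open>\<nabla>\<^sup>dR\<close> at \<open>p\<close>, applied to the list \<open>[x\<^sub>1, \<dots>, x\<^bsub>d+4\<^esub>]\<close> of tangent vectors.\<close>

definition nabla_R ::
  "('a, real^'m::finite) chart set \<Rightarrow> ('a, real^'m) metric_field \<Rightarrow> nat \<Rightarrow> 'a
    \<Rightarrow> ('a, real^'m) tvec list \<Rightarrow> real"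
where
  "nabla_R A g d p xs =
     (let c = chart_at A p; G = metric_coords A g c in
      \<Sum>js\<in>{js. length js = d + 4}.
        (cov_deriv G ^^ d) (curv_comps G) js (snd c p) * (\<Prod>n<d + 4. (xs ! n) c $ (js ! n)))"

text \<open>\<open>\<nabla>\<^sup>d\<RR>\<close> at \<open>p\<close>: the list \<open>xs\<close> is \<open>[x\<^sub>1, x\<^sub>2, x\<^sub>5, \<dots>, x\<^bsub>d+4\<^esub>]\<close>, and
  \<open>z = x\<^sub>3\<close> is the argument of the resulting endomorphism.\<close>

definition nabla_curv_op ::
  "('a, real^'m::finite) chart set \<Rightarrow> ('a, real^'m) metric_field \<Rightarrow> nat \<Rightarrow> 'a
    \<Rightarrow> ('a, real^'m) tvec list \<Rightarrow> ('a, real^'m) tvec \<Rightarrow> ('a, real^'m) tvec"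
where
  "nabla_curv_op A g d p xs z =
     (let c = chart_at A p; G = metric_coords A g c in
      tvec_of A p c (\<chi> l. \<Sum>js\<in>{js. length js = d + 2}. \<Sum>k\<in>UNIV.
        (cov_deriv_end G ^^ d) (curv_op_comps G) js k l (snd c p)
        * (\<Prod>n<d + 2. (xs ! n) c $ (js ! n)) * z c $ k))"

section \<open>Linear homotheties and isometries between tangent spaces, bases\<close>

definition tangent_iso ::
  "('a, real^'m::finite) chart set \<Rightarrow> 'a \<Rightarrow> 'a
    \<Rightarrow> (('a, real^'m) tvec \<Rightarrow> ('a, real^'m) tvec) \<Rightarrow> bool"
where
  "tangent_iso A p q \<Phi> \<longleftrightarrow>
     bij_betw \<Phi> (tangent_space A p) (tangent_space A q) \<and>
     (\<forall>x\<in>tangent_space A p. \<forall>y\<in>tangent_space A p. \<Phi> (x + y) = \<Phi> x + \<Phi> y) \<and>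
     (\<forall>a. \<forall>x\<in>tangent_space A p. \<Phi> (a *\<^sub>R x) = a *\<^sub>R \<Phi> x)"

definition linear_homothety ::
  "('a, real^'m::finite) chart set \<Rightarrow> ('a, real^'m) metric_field \<Rightarrow> 'a \<Rightarrow> 'a
    \<Rightarrow> (('a, real^'m) tvec \<Rightarrow> ('a, real^'m) tvec) \<Rightarrow> bool"
where
  "linear_homothety A g p q \<Phi> \<longleftrightarrow>
     tangent_iso A p q \<Phi> \<and>
     (\<exists>\<mu>::real. \<mu> \<noteq> 0 \<and>
        (\<forall>x\<in>tangent_space A p. \<forall>y\<in>tangent_space A p. g q (\<Phi> x) (\<Phi> y) = \<mu>^2 * g p x y))"

definition linear_isometry ::
  "('a, real^'m::finite) chart set \<Rightarrow> ('a, real^'m) metric_field \<Rightarrow> 'a \<Rightarrow> 'a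
    \<Rightarrow> (('a, real^'m) tvec \<Rightarrow> ('a, real^'m) tvec) \<Rightarrow> bool"
where
  "linear_isometry A g p q \<phi> \<longleftrightarrow>
     tangent_iso A p q \<phi> \<and>
     (\<forall>x\<in>tangent_space A p. \<forall>y\<in>tangent_space A p. g q (\<phi> x) (\<phi> y) = g p x y)"

definition tangent_basis ::
  "('a, real^'m::finite) chart set \<Rightarrow> 'a \<Rightarrow> ('m \<Rightarrow> ('a, real^'m) tvec) \<Rightarrow> bool"
where
  "tangent_basis A p \<xi> \<longleftrightarrow>
     inj \<xi> \<and> independent (range \<xi>) \<and> span (range \<xi>) = tangent_space A p"

section \<open>The three conditions for homothety \<open>k\<close>-curvature homogeneity\<close>

definition homothety_condition ::
  "'a topology \<Rightarrow> ('a, real^'m::finite) chart set \<Rightarrow> ('a, real^'m) metric_field \<Rightarrow> nat \<Rightarrow> bool"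
where
  "homothety_condition M A g k \<longleftrightarrow>
     (\<forall>P\<in>topspace M. \<forall>Q\<in>topspace M. \<exists>\<Phi>. linear_homothety A g P Q \<Phi> \<and>
        (\<forall>d\<le>k. \<forall>xs z. length xs = d + 2 \<and> set xs \<subseteq> tangent_space A P \<and> z \<in> tangent_space A P \<longrightarrow>
           \<Phi> (nabla_curv_op A g d P xs z) = nabla_curv_op A g d Q (map \<Phi> xs) (\<Phi> z)))"

definition isometry_condition ::
  "'a topology \<Rightarrow> ('a, real^'m::finite) chart set \<Rightarrow> ('a, real^'m) metric_field \<Rightarrow> nat \<Rightarrow> bool"
where
  "isometry_condition M A g k \<longleftrightarrow>
     (\<forall>P\<in>topspace M. \<forall>Q\<in>topspace M. \<exists>\<phi>. \<exists>\<mu>::real. linear_isometry A g P Q \<phi> \<and> \<mu> \<noteq> 0 \<and>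
        (\<forall>d\<le>k. \<forall>xs. length xs = d + 4 \<and> set xs \<subseteq> tangent_space A P \<longrightarrow>
           nabla_R A g d Q (map \<phi> xs) = \<mu> powi (- int d - 2) * nabla_R A g d P xs))"

text \<open>The constants \<open>c\<close> of all orders \<open>d\<close> form one function on index lists, since \<open>d\<close> is
  determined by the length \<open>d + 4\<close> of the list.\<close>

definition basis_condition ::
  "'a topology \<Rightarrow> ('a, real^'m::finite) chart set \<Rightarrow> ('a, real^'m) metric_field \<Rightarrow> nat \<Rightarrow> bool"
where
  "basis_condition M A g k \<longleftrightarrow>
     (\<exists>(\<epsilon> :: 'm \<Rightarrow> 'm \<Rightarrow> real) (c :: 'm list \<Rightarrow> real). \<forall>Q\<in>topspace M.
        \<exists>\<xi>. \<exists>\<mu>::real. tangent_basis A Q \<xi> \<and> \<mu> \<noteq> 0 \<and>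
          (\<forall>i j. g Q (\<xi> i) (\<xi> j) = \<epsilon> i j) \<and>
          (\<forall>d\<le>k. \<forall>js. length js = d + 4 \<longrightarrow>
             nabla_R A g d Q (map \<xi> js) = \<mu> powi (- int d - 2) * c js))"

end

theory Submission
  imports Defs
begin

text \<open>If \<open>\<Phi>\<close> is a homothety of factor \<open>\<mu>\<^sup>2\<close> that matches the curvature operators, then
  \<open>\<phi> = \<mu>\<^sup>-\<^sup>1 \<Phi>\<close> is an isometry; inserting \<open>\<phi>\<close> into the \<open>d + 4\<close> slots of \<open>\<nabla>\<^sup>dR\<close>
  produces \<open>\<mu>\<close> to the power \<open>- d - 4\<close>, and the metric used to lower the index gives \<open>\<mu>\<^sup>2\<close> back.
  For the converse take \<open>\<Phi> = \<mu> \<phi>\<close> and cancel the nondegenerate metric. Both directions rest on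
  \<open>\<nabla>\<^sup>dR(x\<^sub>1, x\<^sub>2, x\<^sub>3, x\<^sub>4; \<dots>) = g(\<nabla>\<^sup>d\<RR>(x\<^sub>1, x\<^sub>2; \<dots>) x\<^sub>3, x\<^sub>4)\<close>, which holds since
  \<open>\<nabla>g = 0\<close> lets covariant differentiation commute with lowering an index. The third condition
  is the second one read off in a basis transported from a fixed point.\<close>

section \<open>Partial derivatives and smooth functions\<close>

text \<open>No differentiability is assumed: both functions have the same derivatives at
  \<open>x\<close>, so the choice inside \<open>frechet_derivative\<close> picks the same map for
  both.\<close>

lemma partial_cong:
  assumes "open S" "x \<in> S" "\<And>y. y \<in> S \<Longrightarrow> f y = g y"
  shows "partial i f x = partial i g x"
proof -
  have "(f has_derivative f') (at x) \<longleftrightarrow> (g has_derivative f') (at x)" for f'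
    using assms has_derivative_transform_within_open[of f f' x UNIV S g]
      has_derivative_transform_within_open[of g f' x UNIV S f] by auto
  then show ?thesis
    by (simp add: partial_def frechet_derivative_def)
qed

lemma partial_eqI:
  assumes "(f has_derivative f') (at x)"
  shows "partial i f x = f' (axis i 1)"
  using frechet_derivative_at[OF assms] by (simp add: partial_def)

lemma partial_const: "partial i (\<lambda>x. c) x = 0"
  by (rule partial_eqI) (auto intro!: derivative_eq_intros)

lemma partial_add:
  assumes "f differentiable at x" "g differentiable at x"
  shows "partial i (\<lambda>y. f y + g y) x = partial i f x + partial i g x"
  using partial_eqI[OF has_derivative_add[OF frechet_derivative_works[THEN iffD1, OF assms(1)]
      frechet_derivative_works[THEN iffD1, OF assms(2)]]]
  by (simp add: partial_def)

lemma partial_sum: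
  assumes "finite I" "\<And>a. a \<in> I \<Longrightarrow> f a differentiable at x"
  shows "partial i (\<lambda>y. \<Sum>a\<in>I. f a y) x = (\<Sum>a\<in>I. partial i (f a) x)"
  using assms by (induction I rule: finite_induct) (auto simp: partial_const partial_add)

lemma partial_mult:
  fixes f g :: "real^'m::finite \<Rightarrow> real"
  assumes "f differentiable at x" "g differentiable at x"
  shows "partial i (\<lambda>y. f y * g y) x = f x * partial i g x + partial i f x * g x"
  using partial_eqI[OF has_derivative_mult[OF frechet_derivative_works[THEN iffD1, OF assms(1)]
      frechet_derivative_works[THEN iffD1, OF assms(2)]]]
  by (simp add: partial_def)

lemma partial_inverse:
  fixes f :: "real^'m::finite \<Rightarrow> real"
  assumes "f differentiable at x" "f x \<noteq> 0"
  shows "partial i (\<lambda>y. inverse (f y)) x = - (inverse (f x) * partial i f x * inverse (f x))"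
  using partial_eqI[OF Deriv.has_derivative_inverse[OF assms(2) frechet_derivative_works[THEN iffD1, OF assms(1)]]]
  by (simp add: partial_def)

lemma partial_bounded_linear:
  assumes "bounded_linear h" "f differentiable at x"
  shows "partial i (\<lambda>y. h (f y)) x = h (partial i f x)"
  using partial_eqI[OF bounded_linear.has_derivative[OF assms(1) frechet_derivative_works[THEN iffD1, OF assms(2)]]]
  by (simp add: partial_def)

section \<open>Closure properties of the classes \<open>Ck_on\<close>\<close>

lemma Ck_on_differentiable_at:
  assumes "Ck_on (Suc k) S f" "open S" "x \<in> S"
  shows "f differentiable at x"
  using assms by (auto simp: differentiable_on_eq_differentiable_at)

text \<open>The derivative rules hold only on \<open>S\<close>; the closure proofs use this
  congruence to replace a partial derivative by its formula there.\<close>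

lemma Ck_on_cong:
  assumes "open S" "\<And>x. x \<in> S \<Longrightarrow> f x = g x"
  shows "Ck_on k S f \<longleftrightarrow> Ck_on k S g"
  using assms(2)
proof (induction k arbitrary: f g)
  case 0
  then show ?case by (simp cong: continuous_on_cong)
next
  case (Suc k)
  have "f differentiable_on S \<longleftrightarrow> g differentiable_on S"
    using Suc.prems differentiable_transform_within[of f _ S 1 g]
      differentiable_transform_within[of g _ S 1 f]
    unfolding differentiable_on_def by auto
  moreover have "Ck_on k S (partial i f) \<longleftrightarrow> Ck_on k S (partial i g)" for i
    using Suc.IH partial_cong[OF assms(1)] Suc.prems by blast
  ultimately show ?case by simp
qed

lemma Ck_on_SucD: "Ck_on (Suc k) S f \<Longrightarrow> Ck_on k S f"
proof (induction k arbitrary: f)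
  case 0
  then show ?case by (simp add: differentiable_imp_continuous_on)
next
  case (Suc k)
  then show ?case by (metis Ck_on.simps(2))
qed

lemma Ck_on_const: "Ck_on k S (\<lambda>x. c)"
proof (induction k arbitrary: c)
  case (Suc k)
  moreover have "partial i (\<lambda>x. c) = (\<lambda>x. 0)" for i :: 'a
    by (simp add: fun_eq_iff partial_const)
  ultimately show ?case by simp
qed simp

lemma Ck_on_add:
  assumes "open S" "Ck_on k S f" "Ck_on k S g"
  shows "Ck_on k S (\<lambda>x. f x + g x)"
  using assms(2,3)
proof (induction k arbitrary: f g)
  case 0
  then show ?case by (simp add: continuous_on_add)
next
  case (Suc k)
  have "Ck_on k S (partial i (\<lambda>x. f x + g x))" for i
  proof (subst Ck_on_cong[OF \<open>open S\<close>])
    show "partial i (\<lambda>x. f x + g x) x = partial i f x + partial i g x" if "x \<in> S" for x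
      using that Suc.prems \<open>open S\<close> Ck_on_differentiable_at partial_add by blast
    show "Ck_on k S (\<lambda>x. partial i f x + partial i g x)"
      using Suc by simp
  qed
  then show ?case using Suc.prems by simp
qed

lemma Ck_on_mult:
  fixes f g :: "real^'m::finite \<Rightarrow> real"
  assumes "open S" "Ck_on k S f" "Ck_on k S g"
  shows "Ck_on k S (\<lambda>x. f x * g x)"
  using assms(2,3)
proof (induction k arbitrary: f g)
  case 0
  then show ?case by (simp add: continuous_on_mult)
next
  case (Suc k)
  have "Ck_on k S (partial i (\<lambda>x. f x * g x))" for i
  proof (subst Ck_on_cong[OF \<open>open S\<close>])
    show "partial i (\<lambda>x. f x * g x) x = f x * partial i g x + partial i f x * g x"
      if "x \<in> S" for x
      using that Suc.prems \<open>open S\<close> Ck_on_differentiable_at partial_mult by blast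
    show "Ck_on k S (\<lambda>x. f x * partial i g x + partial i f x * g x)"
      \<comment> \<open>The product rule leaves one factor undifferentiated;
        \<open>Ck_on_SucD\<close> lowers its class to match the inductive hypothesis.\<close>
      using Suc.prems Ck_on_SucD by (intro Ck_on_add[OF \<open>open S\<close>] Suc.IH) auto
  qed
  then show ?case using Suc.prems by simp
qed

text \<open>The function stays fixed in the induction, since a derivative of \<open>1/f\<close> is
  built from \<open>1/f\<close> itself and a partial derivative of \<open>f\<close>.\<close>

lemma Ck_on_inverse:
  fixes f :: "real^'m::finite \<Rightarrow> real"
  assumes "open S" "Ck_on k S f" "\<And>x. x \<in> S \<Longrightarrow> f x \<noteq> 0"
  shows "Ck_on k S (\<lambda>x. inverse (f x))"
  using assms(2)
proof (induction k)
  case 0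
  then show ?case using assms(3) by (simp add: continuous_on_inverse)
next
  case (Suc k)
  have "Ck_on k S (partial i (\<lambda>x. inverse (f x)))" for i
  proof (subst Ck_on_cong[OF \<open>open S\<close>])
    show "partial i (\<lambda>x. inverse (f x)) x
        = (- 1) * (inverse (f x) * partial i f x * inverse (f x))" if "x \<in> S" for x
      using that Suc.prems assms Ck_on_differentiable_at partial_inverse by fastforce
    show "Ck_on k S (\<lambda>x. (- 1) * (inverse (f x) * partial i f x * inverse (f x)))"
      using Suc Ck_on_SucD[OF Suc.prems] by (intro Ck_on_mult[OF \<open>open S\<close>] Ck_on_const) auto
  qed
  then show ?case
    using Suc.prems assms(1,3)
    by (simp add: differentiable_on_eq_differentiable_at differentiable_inverse)
qed

lemma Ck_on_bounded_linear:
  assumes "open S" "bounded_linear h" "Ck_on k S f"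
  shows "Ck_on k S (\<lambda>x. h (f x))"
  using assms(3)
proof (induction k arbitrary: f)
  case 0
  then show ?case
    using assms(2) by (simp add: bounded_linear.continuous_on)
next
  case (Suc k)
  have "Ck_on k S (partial i (\<lambda>x. h (f x)))" for i
  proof (subst Ck_on_cong[OF \<open>open S\<close>])
    show "partial i (\<lambda>x. h (f x)) x = h (partial i f x)" if "x \<in> S" for x
      using that Suc.prems assms Ck_on_differentiable_at partial_bounded_linear by blast
    show "Ck_on k S (\<lambda>x. h (partial i f x))"
      using Suc by simp
  qed
  moreover have "(\<lambda>x. h (f x)) differentiable at x" if "x \<in> S" for x
    using Ck_on_differentiable_at[OF Suc.prems \<open>open S\<close> that]
      bounded_linear.has_derivative[OF assms(2)] unfolding differentiable_def by blast
  ultimately show ?case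
    using assms(1) by (simp add: differentiable_on_eq_differentiable_at)
qed

lemma smooth_on_differentiable_at:
  assumes "smooth_on S f" "open S" "x \<in> S"
  shows "f differentiable at x"
  using assms Ck_on_differentiable_at unfolding smooth_on_def by blast

lemma smooth_on_cong:
  "open S \<Longrightarrow> (\<And>x. x \<in> S \<Longrightarrow> f x = g x) \<Longrightarrow> smooth_on S f \<longleftrightarrow> smooth_on S g"
  unfolding smooth_on_def using Ck_on_cong by blast

lemma smooth_on_partial: "smooth_on S f \<Longrightarrow> smooth_on S (partial i f)"
  unfolding smooth_on_def by (metis Ck_on.simps(2))

lemma smooth_on_const: "smooth_on S (\<lambda>x. c)"
  by (simp add: smooth_on_def Ck_on_const)

lemma smooth_on_add:
  "open S \<Longrightarrow> smooth_on S f \<Longrightarrow> smooth_on S g \<Longrightarrow> smooth_on S (\<lambda>x. f x + g x)"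
  by (simp add: smooth_on_def Ck_on_add)

lemma smooth_on_bounded_linear:
  "open S \<Longrightarrow> bounded_linear h \<Longrightarrow> smooth_on S f \<Longrightarrow> smooth_on S (\<lambda>x. h (f x))"
  by (simp add: smooth_on_def Ck_on_bounded_linear)

lemma smooth_on_component:
  "open S \<Longrightarrow> smooth_on S f \<Longrightarrow> smooth_on S (\<lambda>x. f x $ i)"
  by (rule smooth_on_bounded_linear[OF _ bounded_linear_vec_nth])

lemma smooth_on_mult:
  fixes f g :: "real^'m::finite \<Rightarrow> real"
  shows "open S \<Longrightarrow> smooth_on S f \<Longrightarrow> smooth_on S g \<Longrightarrow> smooth_on S (\<lambda>x. f x * g x)"
  by (simp add: smooth_on_def Ck_on_mult)

lemma smooth_on_diff:
  assumes "open S" "smooth_on S f" "smooth_on S g"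
  shows "smooth_on S (\<lambda>x. f x - g x)"
  using smooth_on_add[OF assms(1,2)
      smooth_on_bounded_linear[OF assms(1) bounded_linear_minus[OF bounded_linear_ident] assms(3)]]
  by simp

lemma smooth_on_inverse:
  fixes f :: "real^'m::finite \<Rightarrow> real"
  shows "open S \<Longrightarrow> smooth_on S f \<Longrightarrow> (\<And>x. x \<in> S \<Longrightarrow> f x \<noteq> 0) \<Longrightarrow> smooth_on S (\<lambda>x. inverse (f x))"
  by (simp add: smooth_on_def Ck_on_inverse)

lemma smooth_on_sum:
  assumes "open S" "\<And>a. a \<in> I \<Longrightarrow> smooth_on S (f a)"
  shows "smooth_on S (\<lambda>x. \<Sum>a\<in>I. f a x)"
proof (cases "finite I")
  case True
  then show ?thesis using assms(2)
    by (induction I rule: finite_induct) (auto simp: smooth_on_const smooth_on_add[OF assms(1)])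
qed (simp add: smooth_on_const)

lemma smooth_on_prod:
  fixes f :: "'i \<Rightarrow> real^'m::finite \<Rightarrow> real"
  assumes "open S" "\<And>a. a \<in> I \<Longrightarrow> smooth_on S (f a)"
  shows "smooth_on S (\<lambda>x. \<Prod>a\<in>I. f a x)"
proof (cases "finite I")
  case True
  then show ?thesis using assms(2)
    by (induction I rule: finite_induct) (auto simp: smooth_on_const smooth_on_mult[OF assms(1)])
qed (simp add: smooth_on_const)

section \<open>Smoothness of determinants and inverse matrices\<close>

lemma smooth_on_det:
  fixes F :: "real^'m::finite \<Rightarrow> real^'n^'n::finite"
  assumes "open S" "\<And>i j. smooth_on S (\<lambda>x. F x $ i $ j)"
  shows "smooth_on S (\<lambda>x. det (F x))"
  unfolding det_def
  by (intro smooth_on_sum smooth_on_mult smooth_on_prod smooth_on_const assms)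

lemma mat_mul_matrix_inv:
  fixes F :: "'a::semiring_1^'n^'m"
  assumes "invertible F"
  shows "F ** matrix_inv F = mat 1"
  using someI_ex[OF assms[unfolded invertible_def]] by (simp add: matrix_inv_def)

text \<open>Cramer's rule, applied to the column of the inverse that solves
  \<open>F *v x = axis j 1\<close>. Each entry becomes a quotient of determinants, from which
  smoothness can be read off.\<close>

lemma matrix_inv_component:
  fixes F :: "real^'n^'n::finite"
  assumes "det F \<noteq> 0"
  shows "matrix_inv F $ i $ j
    = det (\<chi> r s. if s = i then axis j 1 $ r else F $ r $ s) * inverse (det F)"
proof -
  have "F ** matrix_inv F = mat 1"
    using assms by (simp add: invertible_det_nz mat_mul_matrix_inv)
  then have "F *v (\<chi> i. matrix_inv F $ i $ j) = axis j 1"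
    by (auto simp: vec_eq_iff matrix_vector_mult_def matrix_matrix_mult_def mat_def axis_def)
  then have "(\<chi> i. matrix_inv F $ i $ j)
    = (\<chi> k. det (\<chi> r s. if s = k then axis j 1 $ r else F $ r $ s) / det F)"
    using cramer[OF assms] by blast
  then show ?thesis
    by (simp add: vec_eq_iff divide_inverse)
qed

lemma smooth_on_matrix_inv:
  fixes F :: "real^'m::finite \<Rightarrow> real^'n^'n::finite"
  assumes "open S" "smooth_on S F" "\<And>x. x \<in> S \<Longrightarrow> det (F x) \<noteq> 0"
  shows "smooth_on S (\<lambda>x. matrix_inv (F x) $ i $ j)"
proof -
  have F: "smooth_on S (\<lambda>x. F x $ i $ j)" for i j
    by (intro smooth_on_component assms(1,2))
  have *: "smooth_on S (\<lambda>x. (\<chi> r s. if s = i then axis j 1 $ r else F x $ r $ s) $ a $ b)" for a b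
    using F by (cases "b = i") (auto intro: smooth_on_const)
  have "smooth_on S (\<lambda>x. det (\<chi> r s. if s = i then axis j 1 $ r else F x $ r $ s)
      * inverse (det (F x)))"
    by (intro smooth_on_mult smooth_on_inverse smooth_on_det assms F *)
  then show ?thesis
    by (subst smooth_on_cong[OF assms(1) matrix_inv_component[OF assms(3)]])
qed

section \<open>Metric compatibility\<close>

text \<open>The local data of a metric in one chart, stated for a bare matrix function so that the
  tensor calculus can be done without a manifold.\<close>

definition metric_matrix_on :: "(real^'m::finite) set \<Rightarrow> (real^'m \<Rightarrow> real^'m^'m) \<Rightarrow> bool"
  where "metric_matrix_on S G \<longleftrightarrow> open S \<and> smooth_on S G \<and>
    (\<forall>x\<in>S. det (G x) \<noteq> 0 \<and> (\<forall>i j. G x $ i $ j = G x $ j $ i))"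

lemma smooth_on_christoffel:
  assumes "metric_matrix_on S G"
  shows "smooth_on S (christoffel G l i j)"
proof -
  have S: "open S" and G: "smooth_on S G"
    using assms by (auto simp: metric_matrix_on_def)
  have "smooth_on S (\<lambda>x. (1/2) * (\<Sum>a\<in>UNIV. matrix_inv (G x) $ l $ a *
        (partial i (\<lambda>y. G y $ j $ a) x + partial j (\<lambda>y. G y $ i $ a) x
         - partial a (\<lambda>y. G y $ i $ j) x)))"
    using assms
    by (intro smooth_on_mult smooth_on_const smooth_on_sum smooth_on_diff smooth_on_add
        smooth_on_partial smooth_on_component smooth_on_matrix_inv S G)
      (auto simp: metric_matrix_on_def)
  then show ?thesis
    by (simp add: christoffel_def[abs_def])
qed

text \<open>These are the Christoffel symbols of the first kind: contraction with \<open>G\<close>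
  cancels the inverse matrix that raised the index.\<close>

lemma christoffel_lower:
  assumes "metric_matrix_on S G" "x \<in> S"
  shows "(\<Sum>a\<in>UNIV. christoffel G a i j x * G x $ a $ l)
    = (1/2) * (partial i (\<lambda>y. G y $ j $ l) x + partial j (\<lambda>y. G y $ i $ l) x
         - partial l (\<lambda>y. G y $ i $ j) x)"
proof -
  define D where "D b = partial i (\<lambda>y. G y $ j $ b) x + partial j (\<lambda>y. G y $ i $ b) x
         - partial b (\<lambda>y. G y $ i $ j) x" for b
  have "G x ** matrix_inv (G x) = mat 1"
    using assms by (simp add: metric_matrix_on_def invertible_det_nz mat_mul_matrix_inv)
  then have "(\<Sum>a\<in>UNIV. G x $ l $ a * matrix_inv (G x) $ a $ b) = (if l = b then 1 else 0)" for b
    by (simp add: vec_eq_iff matrix_matrix_mult_def mat_def)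
  \<comment> \<open>The product with the inverse contracts the second index of \<open>G x\<close>;
    by symmetry the first index may be contracted instead.\<close>
  then have inv: "(\<Sum>a\<in>UNIV. matrix_inv (G x) $ a $ b * G x $ a $ l) = (if l = b then 1 else 0)" for b
    using assms by (simp add: metric_matrix_on_def mult.commute)
  have "(\<Sum>a\<in>UNIV. christoffel G a i j x * G x $ a $ l)
      = (\<Sum>a\<in>UNIV. \<Sum>b\<in>UNIV. (1/2) * (D b * (matrix_inv (G x) $ a $ b * G x $ a $ l)))"
    by (simp add: christoffel_def D_def sum_distrib_left sum_distrib_right ac_simps)
  also have "\<dots> = (\<Sum>b\<in>UNIV. \<Sum>a\<in>UNIV. (1/2) * (D b * (matrix_inv (G x) $ a $ b * G x $ a $ l)))"
    by (rule sum.swap)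
  also have "\<dots> = (1/2) * (\<Sum>b\<in>UNIV. D b * (\<Sum>a\<in>UNIV. matrix_inv (G x) $ a $ b * G x $ a $ l))"
    by (simp only: sum_distrib_left)
  also have "\<dots> = (1/2) * D l"
    by (simp add: inv if_distrib cong: if_cong)
  finally show ?thesis by (simp add: D_def)
qed

text \<open>This is \<nabla>g = 0 in coordinates. In the sum of the two first-kind symbols four of
  the six derivatives cancel, and symmetry of \<open>G\<close> identifies the other two.\<close>

lemma metric_compatible:
  assumes "metric_matrix_on S G" "x \<in> S"
  shows "partial m (\<lambda>y. G y $ b $ l) x
    = (\<Sum>a\<in>UNIV. christoffel G a m b x * G x $ a $ l)
      + (\<Sum>a\<in>UNIV. christoffel G a m l x * G x $ b $ a)"
proof -
  have sym: "partial i (\<lambda>y. G y $ r $ s) x = partial i (\<lambda>y. G y $ s $ r) x" for i r s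
    using assms by (intro partial_cong[of S]) (auto simp: metric_matrix_on_def)
  have "(\<Sum>a\<in>UNIV. christoffel G a m l x * G x $ b $ a)
      = (\<Sum>a\<in>UNIV. christoffel G a m l x * G x $ a $ b)"
    using assms by (simp add: metric_matrix_on_def)
  then show ?thesis
    unfolding christoffel_lower[OF assms] sym[of m l b] by (simp add: field_simps)
qed

text \<open>Index lists of \<open>\<nabla>\<^sup>dR\<close> are \<open>[i\<^sub>1, i\<^sub>2, i\<^sub>3, i\<^sub>4, i\<^sub>5, \<dots>]\<close>, those of
  \<open>\<nabla>\<^sup>d\<RR>\<close> are \<open>[i\<^sub>1, i\<^sub>2, i\<^sub>5, \<dots>]\<close>, with the endomorphism acting on the index \<open>i\<^sub>3\<close>.\<close>

definition lower_end ::
  "(real^'m \<Rightarrow> real^'m^'m) \<Rightarrow> 'm::finite end_comps \<Rightarrow> 'm cov_comps"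
  where "lower_end G T js x =
    (\<Sum>a\<in>UNIV. T (js ! 0 # js ! 1 # drop 4 js) (js ! 2) a x * G x $ a $ (js ! 3))"

text \<open>Holds for lists of any length, because \<open>curv_op_comps\<close> reads only the first
  two indices and so ignores the tail \<open>drop 4 js\<close> passed by
  \<open>lower_end\<close>.\<close>

lemma curv_comps_eq_lower_end: "curv_comps G = lower_end G (curv_op_comps G)"
  by (simp add: fun_eq_iff curv_comps_def lower_end_def curv_op_comps_def)

text \<open>Updating an entry keeps the length, so \<open>cov_deriv\<close> at \<open>js\<close>
  reads its operand only on lists one shorter. Agreement on those lists is all that an induction
  restricted by length provides.\<close>

lemma cov_deriv_cong:
  assumes "open S" "x \<in> S" "js \<noteq> []"
    and "\<And>ks y. length ks = length js - 1 \<Longrightarrow> y \<in> S \<Longrightarrow> T ks y = T' ks y"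
  shows "cov_deriv G T js x = cov_deriv G T' js x"
  using assms partial_cong[OF assms(1,2), of "T (butlast js)" "T' (butlast js)"]
  by (simp add: cov_deriv_def Let_def)

text \<open>The Leibniz rule differentiates \<open>G\<close>, and \<open>metric_compatible\<close>
  splits that derivative in two: one half cancels the correction in the lowered slot, the other is
  the correction for the upper index of the endomorphism. All remaining terms match slot by
  slot.\<close>

lemma cov_deriv_lower_end:
  assumes G: "metric_matrix_on S G" and x: "x \<in> S"
    and T: "\<And>ks k l. T ks k l differentiable at x"
  shows "cov_deriv G (lower_end G T) (i # j # k # l # ks @ [m]) x
    = lower_end G (cov_deriv_end G T) (i # j # k # l # ks @ [m]) x"
proof -
  define g where "g a b = G x $ a $ b" for a b
  define \<Gamma> where "\<Gamma> a b c = christoffel G a b c x" for a b c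
  define ijs where "ijs = i # j # ks"
  define W where "W n a b = T (ijs[n := a]) k b x" for n a b
  define V where "V = (\<lambda>c b. T ijs c b x)"
  have Gd: "(\<lambda>y. G y $ a $ b) differentiable at x" for a b
  proof (rule smooth_on_differentiable_at[OF _ _ x])
    show "open S" using G by (simp add: metric_matrix_on_def)
    show "smooth_on S (\<lambda>y. G y $ a $ b)"
      using G by (intro smooth_on_component) (simp_all add: metric_matrix_on_def)
  qed
  have low: "lower_end G T (i # j # k # l # ks) = (\<lambda>y. \<Sum>a\<in>UNIV. T ijs k a y * G y $ a $ l)"
    by (simp add: lower_end_def fun_eq_iff ijs_def)
  have "partial m (lower_end G T (i # j # k # l # ks)) x
      = (\<Sum>b\<in>UNIV. V k b * partial m (\<lambda>y. G y $ b $ l) x + partial m (T ijs k b) x * g b l)"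
    unfolding low
    by (subst partial_sum) (auto simp: partial_mult T Gd differentiable_mult V_def g_def)
  also have "\<dots> = (\<Sum>b\<in>UNIV. V k b * (\<Sum>a\<in>UNIV. \<Gamma> a m b * g a l))
      + (\<Sum>b\<in>UNIV. V k b * (\<Sum>a\<in>UNIV. \<Gamma> a m l * g b a))
      + (\<Sum>b\<in>UNIV. partial m (T ijs k b) x * g b l)"
    by (simp add: metric_compatible[OF G x] g_def \<Gamma>_def sum.distrib algebra_simps)
  finally have P: "partial m (lower_end G T (i # j # k # l # ks)) x = \<dots>" .
  \<comment> \<open>This half of the derivative of \<open>G\<close> becomes the upper index
    correction of \<open>cov_deriv_end\<close>.\<close>
  have swap1: "(\<Sum>b\<in>UNIV. V k b * (\<Sum>a\<in>UNIV. \<Gamma> a m b * g a l))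
      = (\<Sum>b\<in>UNIV. (\<Sum>a\<in>UNIV. \<Gamma> b m a * V k a) * g b l)"
    unfolding sum_distrib_left sum_distrib_right
    by (subst sum.swap) (simp add: ac_simps)
  \<comment> \<open>This half equals the correction for the slot \<open>l\<close> and will cancel
    against it.\<close>
  have swap2: "(\<Sum>b\<in>UNIV. V k b * (\<Sum>a\<in>UNIV. \<Gamma> a m l * g b a))
      = (\<Sum>a\<in>UNIV. \<Gamma> a m l * (\<Sum>b\<in>UNIV. V k b * g b a))"
    unfolding sum_distrib_left sum_distrib_right
    by (subst sum.swap) (simp add: ac_simps)
  have swap3: "(\<Sum>a\<in>UNIV. \<Gamma> a m k * (\<Sum>b\<in>UNIV. V a b * g b l))
      = (\<Sum>b\<in>UNIV. (\<Sum>a\<in>UNIV. \<Gamma> a m k * V a b) * g b l)"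
    unfolding sum_distrib_left sum_distrib_right
    by (subst sum.swap) (simp add: ac_simps)
  have swap4: "(\<Sum>a\<in>UNIV. \<Gamma> a m (ijs ! n) * (\<Sum>b\<in>UNIV. W n a b * g b l))
      = (\<Sum>b\<in>UNIV. (\<Sum>a\<in>UNIV. \<Gamma> a m (ijs ! n) * W n a b) * g b l)" for n
    unfolding sum_distrib_left sum_distrib_right
    by (subst sum.swap) (simp add: ac_simps)
  have swap5: "(\<Sum>n<length ijs. \<Sum>a\<in>UNIV. \<Gamma> a m (ijs ! n) * (\<Sum>b\<in>UNIV. W n a b * g b l))
      = (\<Sum>b\<in>UNIV. (\<Sum>n<length ijs. \<Sum>a\<in>UNIV. \<Gamma> a m (ijs ! n) * W n a b) * g b l)"
    unfolding swap4 by (subst sum.swap) (simp add: sum_distrib_right)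
  \<comment> \<open>The corrections are sorted by slot: the argument \<open>k\<close>, the lowered
    index \<open>l\<close>, and the slots \<open>ijs\<close> that remain in the list of the
    operator.\<close>
  have corr: "(\<Sum>n<length (i # j # k # l # ks). \<Sum>a\<in>UNIV. \<Gamma> a m ((i # j # k # l # ks) ! n)
        * lower_end G T ((i # j # k # l # ks)[n := a]) x)
      = (\<Sum>a\<in>UNIV. \<Gamma> a m k * (\<Sum>b\<in>UNIV. V a b * g b l))
      + (\<Sum>a\<in>UNIV. \<Gamma> a m l * (\<Sum>b\<in>UNIV. V k b * g b a))
      + (\<Sum>n<length ijs. \<Sum>a\<in>UNIV. \<Gamma> a m (ijs ! n) * (\<Sum>b\<in>UNIV. W n a b * g b l))"
    by (simp add: sum.lessThan_Suc_shift ijs_def W_def V_def lower_end_def g_def del: sum.lessThan_Suc)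
  have L: "cov_deriv G (lower_end G T) (i # j # k # l # ks @ [m]) x
      = partial m (lower_end G T (i # j # k # l # ks)) x
      - (\<Sum>n<length (i # j # k # l # ks). \<Sum>a\<in>UNIV. \<Gamma> a m ((i # j # k # l # ks) ! n)
        * lower_end G T ((i # j # k # l # ks)[n := a]) x)"
    by (simp add: cov_deriv_def Let_def \<Gamma>_def butlast_append)
  have R: "lower_end G (cov_deriv_end G T) (i # j # k # l # ks @ [m]) x
      = (\<Sum>b\<in>UNIV. (partial m (T ijs k b) x
          - (\<Sum>n<length ijs. \<Sum>a\<in>UNIV. \<Gamma> a m (ijs ! n) * W n a b)
          - (\<Sum>a\<in>UNIV. \<Gamma> a m k * V a b)
          + (\<Sum>a\<in>UNIV. \<Gamma> b m a * V k a)) * g b l)"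
    by (simp add: lower_end_def cov_deriv_end_def Let_def \<Gamma>_def V_def W_def g_def ijs_def butlast_append
        del: sum.lessThan_Suc)
  show ?thesis
    unfolding L R P corr swap1 swap2 swap3 swap5
    by (simp only: left_diff_distrib distrib_right sum.distrib sum_subtractf)
qed

section \<open>Curvature components and their covariant derivatives of all orders\<close>

lemma smooth_on_curv_op_comps:
  assumes "metric_matrix_on S G"
  shows "smooth_on S (curv_op_comps G js k l)"
proof -
  have S: "open S" using assms by (simp add: metric_matrix_on_def)
  show ?thesis
    unfolding curv_op_comps_def[abs_def] Let_def
    by (intro smooth_on_add smooth_on_diff smooth_on_sum smooth_on_mult smooth_on_partial
        smooth_on_christoffel S assms)
qed

lemma smooth_on_cov_deriv_end:
  assumes "metric_matrix_on S G" "\<And>ks k l. smooth_on S (T ks k l)"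
  shows "smooth_on S (cov_deriv_end G T js k l)"
proof -
  have S: "open S" using assms by (simp add: metric_matrix_on_def)
  show ?thesis
    unfolding cov_deriv_end_def[abs_def] Let_def
    by (intro smooth_on_add smooth_on_diff smooth_on_sum smooth_on_mult smooth_on_partial
        smooth_on_christoffel S assms)
qed

lemma smooth_on_iterated_cov_deriv_end:
  assumes "metric_matrix_on S G"
  shows "smooth_on S ((cov_deriv_end G ^^ d) (curv_op_comps G) js k l)"
proof (induction d arbitrary: js k l)
  case 0
  show ?case by (simp add: smooth_on_curv_op_comps[OF assms])
next
  case (Suc d)
  show ?case using smooth_on_cov_deriv_end[OF assms Suc.IH] by simp
qed

text \<open>Each differentiation commutes with lowering by \<open>cov_deriv_lower_end\<close>. The
  point varies in the induction, since differentiating the inductive identity requires it on all of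
  the open set \<open>S\<close>.\<close>

lemma iterated_cov_deriv_curv_comps:
  assumes "metric_matrix_on S G" "x \<in> S" "length js = d + 4"
  shows "(cov_deriv G ^^ d) (curv_comps G) js x
    = lower_end G ((cov_deriv_end G ^^ d) (curv_op_comps G)) js x"
  using assms(2,3)
proof (induction d arbitrary: js x)
  case 0
  then show ?case by (simp add: curv_comps_eq_lower_end)
next
  case (Suc d)
  define T where "T = (cov_deriv_end G ^^ d) (curv_op_comps G)"
  have S: "open S" using assms by (simp add: metric_matrix_on_def)
  have T: "T ks k l differentiable at x" for ks k l
    using smooth_on_differentiable_at smooth_on_iterated_cov_deriv_end[OF assms(1)] S Suc.prems
    unfolding T_def by blast
  have "length js = Suc (Suc (Suc (Suc (Suc d))))" using Suc.prems by simp
  then obtain i j k l ks' where js: "js = i # j # k # l # ks'" "length ks' = Suc d"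
    by (auto simp: length_Suc_conv)
  \<comment> \<open>The last index is the direction of the outermost derivative; it exists because
    \<open>ks'\<close> has length \<open>Suc d\<close>.\<close>
  then have js': "js = i # j # k # l # butlast ks' @ [last ks']"
    by (metis append_butlast_last_id length_0_conv nat.distinct(1))
  have "(cov_deriv G ^^ Suc d) (curv_comps G) js x
      = cov_deriv G ((cov_deriv G ^^ d) (curv_comps G)) js x" by simp
  also have "\<dots> = cov_deriv G (lower_end G T) js x"
    using Suc js by (intro cov_deriv_cong[OF S]) (auto simp: T_def)
  also have "\<dots> = lower_end G (cov_deriv_end G T) js x"
    unfolding js' by (rule cov_deriv_lower_end[OF assms(1) \<open>x \<in> S\<close> T])
  finally show ?case by (simp add: T_def)
qed

section \<open>Coordinates on tangent spaces\<close>

lemma chart_at_in_charts_at: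
  assumes "smooth_atlas M A" "p \<in> topspace M"
  shows "chart_at A p \<in> charts_at A p"
proof -
  have "p \<in> (\<Union>c\<in>A. fst c)"
    using assms by (simp add: smooth_atlas_def)
  then have "\<exists>c. c \<in> charts_at A p"
    unfolding charts_at_def by blast
  then show ?thesis
    unfolding chart_at_def by (rule someI_ex)
qed

lemma chart_inj_on:
  assumes "smooth_atlas M A" "c \<in> A"
  shows "inj_on (snd c) (fst c)"
proof -
  have "homeomorphic_map (subtopology M (fst c)) (top_of_set (snd c ` fst c)) (snd c)"
    and "openin M (fst c)"
    using assms by (auto simp: smooth_atlas_def)
  then show ?thesis
    using homeomorphic_imp_injective_map openin_subset by (metis topspace_subtopology_subset)
qed

lemma chart_inv_chart:
  assumes "smooth_atlas M A" "c \<in> A" "p \<in> fst c"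
  shows "chart_inv c (snd c p) = p"
  using chart_inj_on[OF assms(1,2)] assms(3) by (simp add: chart_inv_def)

lemma open_chart_image:
  assumes A: "smooth_atlas M A" and c: "c \<in> A" and U: "openin M U" "U \<subseteq> fst c"
  shows "open (snd c ` U)"
proof -
  have h: "homeomorphic_map (subtopology M (fst c)) (top_of_set (snd c ` fst c)) (snd c)"
    and op: "open (snd c ` fst c)"
    using A c by (auto simp: smooth_atlas_def)
  have "openin (subtopology M (fst c)) U"
    using U by (auto simp: openin_subtopology)
  then have "openin (top_of_set (snd c ` fst c)) (snd c ` U)"
    using homeomorphic_imp_open_map[OF h] by (simp add: open_map_def)
  then show ?thesis
    using op by (simp add: openin_open_eq)
qed

lemma openin_chart_domain: "smooth_atlas M A \<Longrightarrow> c \<in> A \<Longrightarrow> openin M (fst c)"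
  by (simp add: smooth_atlas_def)

section \<open>Transition maps and the coordinates of tangent vectors\<close>

lemma transition_chart:
  assumes "smooth_atlas M A" "c \<in> charts_at A p"
  shows "transition c c' (snd c p) = snd c' p"
  using assms by (simp add: transition_def charts_at_def chart_inv_chart)

lemma transition_has_derivative:
  assumes A: "smooth_atlas M A" and c: "c \<in> charts_at A p" "c' \<in> charts_at A p"
  shows "(transition c c' has_derivative frechet_derivative (transition c c') (at (snd c p)))
    (at (snd c p))"
proof -
  have "smooth_on (snd c ` (fst c \<inter> fst c')) (transition c c')"
    using A c by (auto simp: smooth_atlas_def charts_at_def)
  moreover have "open (snd c ` (fst c \<inter> fst c'))"
    using A c by (intro open_chart_image[OF A]) (auto simp: charts_at_def openin_chart_domain)
  moreover have "snd c p \<in> snd c ` (fst c \<inter> fst c')"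
    using c by (auto simp: charts_at_def)
  ultimately show ?thesis
    using smooth_on_differentiable_at frechet_derivative_works by blast
qed

lemma frechet_derivative_transition_self:
  assumes A: "smooth_atlas M A" and c: "c \<in> charts_at A p"
  shows "frechet_derivative (transition c c) (at (snd c p)) w = w"
proof -
  have "((\<lambda>x. x) has_derivative (\<lambda>x. x)) (at (snd c p))"
    by (rule has_derivative_ident)
  then have "(transition c c has_derivative (\<lambda>x. x)) (at (snd c p))"
  proof (rule has_derivative_transform_within_open)
    show "open (snd c ` fst c)"
      using c by (intro open_chart_image[OF A]) (auto simp: charts_at_def openin_chart_domain[OF A])
    show "snd c p \<in> snd c ` fst c"
      using c by (auto simp: charts_at_def)
    show "x = transition c c x" if "x \<in> snd c ` fst c" for x
      using that c by (auto simp: transition_def charts_at_def chart_inv_chart[OF A])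
  qed
  from frechet_derivative_at[OF this] show ?thesis
    by metis
qed

text \<open>The chain rule: on the image of the triple overlap, an open set, the transition maps
  compose.\<close>

lemma frechet_derivative_transition_trans:
  assumes A: "smooth_atlas M A"
    and c: "c \<in> charts_at A p" "c' \<in> charts_at A p" "c'' \<in> charts_at A p"
  shows "frechet_derivative (transition c' c'') (at (snd c' p))
      (frechet_derivative (transition c c') (at (snd c p)) w)
    = frechet_derivative (transition c c'') (at (snd c p)) w"
proof -
  let ?D = "\<lambda>c c'. frechet_derivative (transition c c') (at (snd c p))"
  have "(transition c' c'' has_derivative ?D c' c'') (at (transition c c' (snd c p)))"
    using transition_has_derivative[OF A c(2,3)] by (simp add: transition_chart[OF A c(1)])
  from diff_chain_at[OF transition_has_derivative[OF A c(1,2)] this]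
  have "(transition c c'' has_derivative ?D c' c'' \<circ> ?D c c') (at (snd c p))"
  proof (rule has_derivative_transform_within_open)
    show "open (snd c ` (fst c \<inter> fst c' \<inter> fst c''))"
      using c by (intro open_chart_image[OF A] openin_Int openin_chart_domain[OF A])
        (auto simp: charts_at_def)
    show "snd c p \<in> snd c ` (fst c \<inter> fst c' \<inter> fst c'')"
      using c by (auto simp: charts_at_def)
    show "(transition c' c'' \<circ> transition c c') x = transition c c'' x"
      if "x \<in> snd c ` (fst c \<inter> fst c' \<inter> fst c'')" for x
      using that c by (auto simp: transition_def charts_at_def chart_inv_chart[OF A])
  qed
  from frechet_derivative_at[OF this] show ?thesis
    by (metis comp_apply)
qed

text \<open>The compatibility demanded by \<open>tangent_space\<close> is exactly the cocycle
  identity of the transition derivatives.\<close>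

lemma tvec_of_in_tangent_space:
  assumes "smooth_atlas M A" "c \<in> charts_at A p"
  shows "tvec_of A p c w \<in> tangent_space A p"
  using frechet_derivative_transition_trans[OF assms]
  by (auto simp: tangent_space_def tvec_of_def)

lemma tvec_of_self:
  assumes "smooth_atlas M A" "c \<in> charts_at A p"
  shows "tvec_of A p c w c = w"
  using assms by (simp add: tvec_of_def frechet_derivative_transition_self)

text \<open>The transition rule lets one chart determine the coordinates in all charts around
  \<open>p\<close>; elsewhere both sides vanish by convention.\<close>

lemma tvec_of_coords:
  assumes c: "c \<in> charts_at A p" and v: "v \<in> tangent_space A p"
  shows "tvec_of A p c (v c) = v"
proof
  fix c'
  have "c' \<in> charts_at A p \<Longrightarrow> v c' = frechet_derivative (transition c c') (at (snd c p)) (v c)"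
    and "c' \<notin> charts_at A p \<Longrightarrow> v c' = 0"
    using c v unfolding tangent_space_def by blast+
  then show "tvec_of A p c (v c) c' = v c'"
    unfolding tvec_of_def by presburger
qed

lemma linear_transition_derivative:
  assumes "smooth_atlas M A" "c \<in> charts_at A p" "c' \<in> charts_at A p"
  shows "linear (frechet_derivative (transition c c') (at (snd c p)))"
  using transition_has_derivative[OF assms] has_derivative_linear by blast

lemma linear_tvec_of:
  assumes "smooth_atlas M A" "c \<in> charts_at A p"
  shows "linear (tvec_of A p c)"
proof
  fix v w :: "real^'b" and a :: real
  show "tvec_of A p c (v + w) = tvec_of A p c v + tvec_of A p c w"
    using linear_transition_derivative[OF assms]
    by (auto simp: tvec_of_def fun_eq_iff linear_add)
  show "tvec_of A p c (a *\<^sub>R v) = a *\<^sub>R tvec_of A p c v"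
    using linear_transition_derivative[OF assms]
    by (auto simp: tvec_of_def fun_eq_iff scaleR_fun_def linear_scale)
qed

lemma bij_betw_tvec_of:
  assumes "smooth_atlas M A" "c \<in> charts_at A p"
  shows "bij_betw (tvec_of A p c) UNIV (tangent_space A p)"
  by (rule bij_betw_byWitness[where f' = "\<lambda>v. v c"])
    (auto simp: tvec_of_in_tangent_space[OF assms] tvec_of_self[OF assms] tvec_of_coords[OF assms(2)])

text \<open>The tangent space is the range of a linear coordinate map. Closure under linear
  operations is needed throughout, as the metric axioms speak of tangent vectors only.\<close>

lemma subspace_tangent_space:
  assumes "smooth_atlas M A" "p \<in> topspace M"
  shows "subspace (tangent_space A p)"
proof -
  have "tangent_space A p = range (tvec_of A p (chart_at A p))"
    using bij_betw_tvec_of[OF assms(1) chart_at_in_charts_at[OF assms]]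
    by (simp add: bij_betw_def)
  then show ?thesis
    using linear_subspace_image[OF linear_tvec_of[OF assms(1) chart_at_in_charts_at[OF assms]] subspace_UNIV]
    by simp
qed

section \<open>The metric in coordinates\<close>

lemma metric_nondegenerate:
  assumes "pseudo_riemannian_metric M A g" "p \<in> topspace M" "x \<in> tangent_space A p"
    and "\<And>y. y \<in> tangent_space A p \<Longrightarrow> g p x y = 0"
  shows "x = 0"
  using assms unfolding pseudo_riemannian_metric_def by blast

lemma metric_commute:
  assumes "pseudo_riemannian_metric M A g" "p \<in> topspace M"
    and "x \<in> tangent_space A p" "y \<in> tangent_space A p"
  shows "g p x y = g p y x"
  using assms unfolding pseudo_riemannian_metric_def by blast

lemma metric_add_left:
  assumes "pseudo_riemannian_metric M A g" "p \<in> topspace M"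
    and "x \<in> tangent_space A p" "y \<in> tangent_space A p" "z \<in> tangent_space A p"
  shows "g p (x + y) z = g p x z + g p y z"
  using assms unfolding pseudo_riemannian_metric_def by blast

lemma metric_scale_left:
  assumes "pseudo_riemannian_metric M A g" "p \<in> topspace M"
    and "x \<in> tangent_space A p" "z \<in> tangent_space A p"
  shows "g p (a *\<^sub>R x) z = a * g p x z"
  using assms unfolding pseudo_riemannian_metric_def by blast

text \<open>The axioms give linearity on the left only; symmetry carries it over to the right
  argument.\<close>

lemma metric_scale_right:
  assumes "smooth_atlas M A" "pseudo_riemannian_metric M A g" "p \<in> topspace M"
    and "x \<in> tangent_space A p" "z \<in> tangent_space A p"
  shows "g p z (a *\<^sub>R x) = a * g p z x"
proof -
  have "a *\<^sub>R x \<in> tangent_space A p"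
    using subspace_tangent_space[OF assms(1,3)] assms(4) by (rule subspace_scale)
  then have "g p z (a *\<^sub>R x) = g p (a *\<^sub>R x) z"
    using metric_commute[OF assms(2,3)] assms(5) by blast
  also have "\<dots> = a * g p z x"
    using metric_scale_left[OF assms(2-5)] metric_commute[OF assms(2,3)] assms(4,5) by simp
  finally show ?thesis .
qed

lemma metric_sum_left:
  assumes A: "smooth_atlas M A" and g: "pseudo_riemannian_metric M A g" and p: "p \<in> topspace M"
    and e: "\<And>i. i \<in> I \<Longrightarrow> e i \<in> tangent_space A p" and z: "z \<in> tangent_space A p" and I: "finite I"
  shows "g p (\<Sum>i\<in>I. a i *\<^sub>R e i) z = (\<Sum>i\<in>I. a i * g p (e i) z)"
  using I e
proof (induction I rule: finite_induct)
  note T = subspace_tangent_space[OF A p]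
  case empty
  show ?case
    \<comment> \<open>The zero vector is treated as a zero multiple, which turns homogeneity into
      the vanishing of the metric on it.\<close>
    using metric_scale_left[OF g p subspace_0[OF T] z, of 0] by (simp only: sum.empty scaleR_zero_left mult_zero_left)
next
  note T = subspace_tangent_space[OF A p]
  case (insert i I)
  have "(\<Sum>i\<in>I. a i *\<^sub>R e i) \<in> tangent_space A p" "a i *\<^sub>R e i \<in> tangent_space A p"
    using insert.prems by (auto intro!: subspace_sum[OF T] subspace_scale[OF T])
  then show ?case
    unfolding sum.insert[OF insert.hyps]
    using insert z by (simp only: metric_add_left[OF g p] metric_scale_left[OF g p] insertI1 insertI2)
qed

lemma metric_sum_sum:
  assumes A: "smooth_atlas M A" and g: "pseudo_riemannian_metric M A g" and p: "p \<in> topspace M"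
    and e: "\<And>i. e i \<in> tangent_space A p" and f: "\<And>j. f j \<in> tangent_space A p"
  shows "g p (\<Sum>i\<in>UNIV. a i *\<^sub>R e i) (\<Sum>j\<in>UNIV. b j *\<^sub>R f j)
    = (\<Sum>i\<in>UNIV. \<Sum>j\<in>UNIV. a i * b j * g p (e (i::'i::finite)) (f (j::'j::finite)))"
proof -
  note T = subspace_tangent_space[OF A p]
  have y: "(\<Sum>j\<in>UNIV. b j *\<^sub>R f j) \<in> tangent_space A p"
    using f by (auto intro!: subspace_sum[OF T] subspace_scale[OF T])
  have "g p (\<Sum>i\<in>UNIV. a i *\<^sub>R e i) (\<Sum>j\<in>UNIV. b j *\<^sub>R f j)
      = (\<Sum>i\<in>UNIV. a i * g p (e i) (\<Sum>j\<in>UNIV. b j *\<^sub>R f j))"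
    using e y by (simp add: metric_sum_left[OF A g p])
  \<comment> \<open>Symmetry moves the second sum to the left, where it can be expanded.\<close>
  also have "\<dots> = (\<Sum>i\<in>UNIV. a i * g p (\<Sum>j\<in>UNIV. b j *\<^sub>R f j) (e i))"
    using e y metric_commute[OF g p] by simp
  also have "\<dots> = (\<Sum>i\<in>UNIV. a i * (\<Sum>j\<in>UNIV. b j * g p (f j) (e i)))"
    using e f by (simp add: metric_sum_left[OF A g p])
  also have "\<dots> = (\<Sum>i\<in>UNIV. \<Sum>j\<in>UNIV. a i * b j * g p (e i) (f j))"
    using e f metric_commute[OF g p] by (simp add: sum_distrib_left mult.assoc)
  finally show ?thesis .
qed

lemma tvec_of_expand:
  assumes "smooth_atlas M A" "c \<in> charts_at A p"
  shows "tvec_of A p c w = (\<Sum>i\<in>UNIV. (w $ i) *\<^sub>R tvec_of A p c (axis i 1))"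
proof -
  have "w = (\<Sum>i\<in>UNIV. (w $ i) *\<^sub>R axis i 1)"
    using basis_expansion[of w] by (simp add: scalar_mult_eq_scaleR)
  then have "tvec_of A p c w = tvec_of A p c (\<Sum>i\<in>UNIV. (w $ i) *\<^sub>R axis i 1)"
    by (rule arg_cong)
  then show ?thesis
    by (simp only: linear_sum[OF linear_tvec_of[OF assms]] linear_scale[OF linear_tvec_of[OF assms]])
qed

lemma metric_tvec_of:
  assumes A: "smooth_atlas M A" and g: "pseudo_riemannian_metric M A g" and p: "p \<in> topspace M"
    and c: "c \<in> charts_at A p"
  shows "g p (tvec_of A p c v) (tvec_of A p c w)
    = (\<Sum>i\<in>UNIV. \<Sum>j\<in>UNIV. v $ i * w $ j * metric_coords A g c (snd c p) $ i $ j)"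
proof -
  have "chart_inv c (snd c p) = p"
    using c chart_inv_chart[OF A] by (simp add: charts_at_def)
  then have "metric_coords A g c (snd c p) $ i $ j
      = g p (tvec_of A p c (axis i 1)) (tvec_of A p c (axis j 1))" for i j
    by (simp add: metric_coords_def)
  then show ?thesis
    unfolding tvec_of_expand[OF A c, of v] tvec_of_expand[OF A c, of w]
    by (simp add: metric_sum_sum[OF A g p] tvec_of_in_tangent_space[OF A c])
qed

text \<open>A kernel vector of the Gram matrix is the coordinate vector of a tangent vector
  orthogonal to everything, hence zero by nondegeneracy. A square matrix with trivial kernel is
  invertible.\<close>

lemma metric_matrix_on_metric_coords:
  assumes A: "smooth_atlas M A" and g: "pseudo_riemannian_metric M A g" and c: "c \<in> A"
  shows "metric_matrix_on (snd c ` fst c) (metric_coords A g c)"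
proof -
  have "det (metric_coords A g c (snd c p)) \<noteq> 0 \<and>
      (\<forall>i j. metric_coords A g c (snd c p) $ i $ j = metric_coords A g c (snd c p) $ j $ i)"
    if "p \<in> fst c" for p
  proof -
    let ?G = "metric_coords A g c (snd c p)"
    have cp: "c \<in> charts_at A p" and p: "p \<in> topspace M"
      using that c A by (auto simp: charts_at_def smooth_atlas_def)
    have sym: "?G $ i $ j = ?G $ j $ i" for i j
      using metric_commute[OF g p] that
      by (simp add: metric_coords_def chart_inv_chart[OF A c] tvec_of_in_tangent_space[OF A cp])
    have "w = 0" if w: "?G *v w = 0" for w
    proof -
      have "g p (tvec_of A p c w) (tvec_of A p c v) = 0" for v
      proof -
        have "g p (tvec_of A p c w) (tvec_of A p c v)
            = (\<Sum>j\<in>UNIV. v $ j * (\<Sum>i\<in>UNIV. ?G $ j $ i * w $ i))"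
          unfolding metric_tvec_of[OF A g p cp] sum_distrib_left
          by (subst sum.swap) (simp add: sym mult.assoc mult.left_commute mult.commute)
        then show ?thesis
          using w by (simp add: vec_eq_iff matrix_vector_mult_def)
      qed
      then have "tvec_of A p c w = 0"
        using metric_nondegenerate[OF g p tvec_of_in_tangent_space[OF A cp]] tvec_of_coords[OF cp]
        by metis
      then show "w = 0"
        using tvec_of_self[OF A cp, of w] by simp
    qed
    then have "invertible ?G"
      unfolding invertible_left_inverse matrix_left_invertible_ker by blast
    then show ?thesis
      using sym by (simp add: invertible_det_nz)
  qed
  moreover have "smooth_on (snd c ` fst c) (metric_coords A g c)" "open (snd c ` fst c)"
    using g A c by (auto simp: pseudo_riemannian_metric_def smooth_atlas_def)
  ultimately show ?thesis
    by (auto simp: metric_matrix_on_def)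
qed

section \<open>Curvature tensor and curvature operator\<close>

text \<open>Peeling off leading indices separates the slots of the curvature from those of the
  derivative directions.\<close>

lemma sum_lists_Suc:
  fixes f :: "'m::finite list \<Rightarrow> 'b::comm_monoid_add"
  shows "(\<Sum>js\<in>{js. length js = Suc n}. f js)
    = (\<Sum>i\<in>UNIV. \<Sum>ks\<in>{ks. length ks = n}. f (i # ks))"
proof -
  have "{js :: 'm list. length js = Suc n} = (\<lambda>(i, ks). i # ks) ` (UNIV \<times> {ks. length ks = n})"
    by (auto simp: length_Suc_conv)
  moreover have "inj_on (\<lambda>(i, ks). i # ks) (UNIV \<times> {ks :: 'm list. length ks = n})"
    by (auto simp: inj_on_def)
  ultimately show ?thesis
    by (simp add: sum.reindex sum.cartesian_product case_prod_unfold)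
qed

text \<open>Distributivity: a list records the summand chosen in each factor. This drives the
  multilinear expansion of \<open>nabla_R\<close>.\<close>

lemma prod_sum_lists:
  fixes f :: "nat \<Rightarrow> 'm::finite \<Rightarrow> 'b::comm_semiring_1"
  shows "(\<Prod>n<N. \<Sum>i\<in>UNIV. f n i) = (\<Sum>js\<in>{js. length js = N}. \<Prod>n<N. f n (js ! n))"
proof (induction N arbitrary: f)
  case (Suc N)
  show ?case
    unfolding prod.lessThan_Suc_shift sum_lists_Suc Suc
    by (simp add: sum_product)
qed simp

lemma nabla_curv_op_in_tangent_space:
  assumes "smooth_atlas M A" "p \<in> topspace M"
  shows "nabla_curv_op A g d p xs z \<in> tangent_space A p"
  by (simp add: nabla_curv_op_def Let_def tvec_of_in_tangent_space[OF assms(1)]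
      chart_at_in_charts_at[OF assms])

text \<open>Contract \<open>iterated_cov_deriv_curv_comps\<close> with the coordinates of the
  vectors. The first three vectors and \<open>ys\<close> enter both sides through coordinates in the
  chosen chart, whereas \<open>g\<close> takes \<open>x4\<close> itself; being tangent,
  \<open>x4\<close> is recovered from its coordinates.\<close>

lemma nabla_R_eq_metric:
  assumes A: "smooth_atlas M A" and g: "pseudo_riemannian_metric M A g" and p: "p \<in> topspace M"
    and xs: "xs = x1 # x2 # x3 # x4 # ys" "length ys = d" and x4: "x4 \<in> tangent_space A p"
  shows "nabla_R A g d p xs = g p (nabla_curv_op A g d p (x1 # x2 # ys) x3) x4"
proof -
  define c where "c = chart_at A p"
  define G where "G = metric_coords A g c"
  define y where "y = snd c p"
  define F where "F js k l = (cov_deriv_end G ^^ d) (curv_op_comps G) js k l y" for js k l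
  define u where "u ks = (\<Prod>n<d. (ys ! n) c $ (ks ! n))" for ks
  have c: "c \<in> charts_at A p"
    using chart_at_in_charts_at[OF A p] by (simp add: c_def)
  have G: "metric_matrix_on (snd c ` fst c) G" and y: "y \<in> snd c ` fst c"
    using metric_matrix_on_metric_coords[OF A g] c by (auto simp: charts_at_def G_def y_def)
  \<comment> \<open>The common summand of both sides, which then differ only in the order of six
    summations.\<close>
  define t where "t i j k l ks a = F (i # j # ks) k a * G y $ a $ l * (x1 c $ i * x2 c $ j
      * x3 c $ k * x4 c $ l * u ks)" for i j k l ks a
  have d4: "d + 4 = Suc (Suc (Suc (Suc d)))" and d2: "d + 2 = Suc (Suc d)"
    by simp_all
  have P4: "(\<Prod>n<Suc (Suc (Suc (Suc d))). (xs ! n) c $ ((i # j # k # l # ks) ! n))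
      = x1 c $ i * x2 c $ j * x3 c $ k * x4 c $ l * u ks" for i j k l ks
    by (simp add: prod.lessThan_Suc_shift xs u_def mult.assoc del: prod.lessThan_Suc)
  have P2: "(\<Prod>n<Suc (Suc d). ((x1 # x2 # ys) ! n) c $ ((i # j # ks) ! n))
      = x1 c $ i * x2 c $ j * u ks" for i j ks
    by (simp add: prod.lessThan_Suc_shift u_def mult.assoc del: prod.lessThan_Suc)
  have low: "lower_end G ((cov_deriv_end G ^^ d) (curv_op_comps G)) (i # j # k # l # ks) y
      = (\<Sum>a\<in>UNIV. F (i # j # ks) k a * G y $ a $ l)" for i j k l ks
    by (simp add: lower_end_def F_def)
  have "nabla_R A g d p xs = (\<Sum>js\<in>{js. length js = d + 4}.
      lower_end G ((cov_deriv_end G ^^ d) (curv_op_comps G)) js y * (\<Prod>n<d + 4. (xs ! n) c $ (js ! n)))"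
    unfolding nabla_R_def Let_def c_def[symmetric] G_def[symmetric] y_def[symmetric]
    by (intro sum.cong refl arg_cong2[where f = "(*)"])
      (simp add: iterated_cov_deriv_curv_comps[OF G y])
  also have "\<dots> = (\<Sum>i\<in>UNIV. \<Sum>j\<in>UNIV. \<Sum>k\<in>UNIV. \<Sum>l\<in>UNIV. \<Sum>ks\<in>{ks. length ks = d}. \<Sum>a\<in>UNIV.
      t i j k l ks a)"
    unfolding d4 sum_lists_Suc P4 low t_def sum_distrib_right ..
  \<comment> \<open>The indices \<open>a\<close> and \<open>l\<close> move outermost, as in
    \<open>metric_tvec_of\<close>: \<open>a\<close> is the upper index of the operator and
    \<open>l\<close> the slot of \<open>x4\<close>.\<close>
  also have "\<dots> = (\<Sum>a\<in>UNIV. \<Sum>l\<in>UNIV. \<Sum>i\<in>UNIV. \<Sum>j\<in>UNIV. \<Sum>ks\<in>{ks. length ks = d}. \<Sum>k\<in>UNIV.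
      t i j k l ks a)"
    unfolding sum.cartesian_product
    by (rule sum.reindex_bij_witness[where i = "\<lambda>(a, l, i, j, ks, k). (i, j, k, l, ks, a)"
          and j = "\<lambda>(i, j, k, l, ks, a). (a, l, i, j, ks, k)"]) auto
  also have "\<dots> = g p (nabla_curv_op A g d p (x1 # x2 # ys) x3) (tvec_of A p c (x4 c))"
    unfolding nabla_curv_op_def Let_def c_def[symmetric] G_def[symmetric] metric_tvec_of[OF A g p c]
      y_def[symmetric]
    unfolding d2 sum_lists_Suc P2 F_def[symmetric] vec_lambda_beta sum_distrib_right t_def
    by (intro sum.cong refl) (simp only: ac_simps)
  also have "tvec_of A p c (x4 c) = x4"
    using tvec_of_coords[OF c x4] .
  finally show ?thesis .
qed

section \<open>Bases and linear isomorphisms of tangent spaces\<close>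

text \<open>Coefficients are packed into a vector so that a family of vectors becomes a linear map
  out of \<open>real^'m\<close>, and being a basis becomes bijectivity.\<close>

definition lincomb :: "('m::finite \<Rightarrow> 'v::real_vector) \<Rightarrow> real^'m \<Rightarrow> 'v"
  where "lincomb \<xi> a = (\<Sum>i\<in>UNIV. (a $ i) *\<^sub>R \<xi> i)"

lemma linear_lincomb: "linear (lincomb \<xi>)"
  by (rule linearI)
    (simp_all add: lincomb_def scaleR_add_left sum.distrib scaleR_sum_right)

lemma lincomb_axis: "lincomb \<xi> (axis i 1) = \<xi> i"
proof -
  have "(axis i 1 $ j) *\<^sub>R \<xi> j = (if j = i then \<xi> j else 0)" for j
    by (simp add: axis_def)
  then show ?thesis by (simp add: lincomb_def)
qed

lemma range_lincomb: "range (lincomb \<xi>) = span (range \<xi>)"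
proof
  show "range (lincomb \<xi>) \<subseteq> span (range \<xi>)"
    unfolding lincomb_def by (intro image_subsetI span_sum span_scale span_base rangeI)
  have "range \<xi> \<subseteq> range (lincomb \<xi>)"
  proof (rule image_subsetI)
    show "\<xi> i \<in> range (lincomb \<xi>)" for i
      by (rule range_eqI[where x = "axis i 1"]) (rule lincomb_axis[symmetric])
  qed
  then show "span (range \<xi>) \<subseteq> range (lincomb \<xi>)"
    by (intro span_minimal linear_subspace_image linear_lincomb subspace_UNIV)
qed

text \<open>A linear map is injective when its kernel is trivial, which here is linear independence
  of the family; its range is the span. Injectivity of \<open>\<xi>\<close> excludes repetitions,
  which \<open>range \<xi>\<close> as a set cannot see.\<close>

lemma tangent_basis_iff:
  "tangent_basis A p \<xi> \<longleftrightarrow> bij_betw (lincomb \<xi>) UNIV (tangent_space A p)"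
proof -
  have "inj \<xi> \<and> independent (range \<xi>) \<longleftrightarrow> inj (lincomb \<xi>)"
  proof
    assume L: "inj \<xi> \<and> independent (range \<xi>)"
    have "a = 0" if "lincomb \<xi> a = 0" for a
    proof -
      \<comment> \<open>Independence concerns the set of vectors, so the coefficients are moved from
        indices to vectors by \<open>inv \<xi>\<close>.\<close>
      have "(\<Sum>v\<in>range \<xi>. (a $ inv \<xi> v) *\<^sub>R v) = 0"
        using L that by (simp add: sum.reindex lincomb_def)
      then have "a $ inv \<xi> (\<xi> i) = 0" for i
        by (intro independentD[of "range \<xi>" "range \<xi>" "\<lambda>v. a $ inv \<xi> v"]) (simp_all add: L)
      then show "a = 0"
        using L by (simp add: vec_eq_iff)
    qed
    then show "inj (lincomb \<xi>)"
      using linear_injective_0[OF linear_lincomb] by blast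
  next
    assume inj: "inj (lincomb \<xi>)"
    have "inj \<xi>"
    proof
      fix i j assume "\<xi> i = \<xi> j"
      then have "axis i (1::real) = axis j 1"
        by (intro injD[OF inj]) (simp only: lincomb_axis)
      then show "i = j" by (simp add: axis_eq_axis)
    qed
    moreover have "independent (range \<xi>)"
    proof (rule independent_if_scalars_zero)
      fix f v assume f: "(\<Sum>v\<in>range \<xi>. f v *\<^sub>R v) = 0" and v: "v \<in> range \<xi>"
      have "lincomb \<xi> (\<chi> i. f (\<xi> i)) = 0"
        using f \<open>inj \<xi>\<close> by (simp add: sum.reindex lincomb_def)
      then have "(\<chi> i. f (\<xi> i)) = 0"
        using inj linear_injective_0[OF linear_lincomb] by blast
      then show "f v = 0" using v by (auto simp: vec_eq_iff)
    qed simp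
    ultimately show "inj \<xi> \<and> independent (range \<xi>)" by blast
  qed
  then show ?thesis
    by (auto simp: tangent_basis_def bij_betw_def range_lincomb)
qed

lemma tangent_basis_in_tangent_space:
  assumes "tangent_basis A p \<xi>"
  shows "\<xi> i \<in> tangent_space A p"
proof -
  have "\<xi> i \<in> span (range \<xi>)"
    by (intro span_base rangeI)
  then show ?thesis
    using assms by (simp only: tangent_basis_def)
qed

lemma tangent_basis_exists:
  assumes "smooth_atlas M A" "p \<in> topspace M"
  shows "\<exists>\<xi>. tangent_basis A p \<xi>"
proof
  note c = chart_at_in_charts_at[OF assms]
  have "lincomb (\<lambda>i. tvec_of A p (chart_at A p) (axis i 1)) = tvec_of A p (chart_at A p)"
    unfolding lincomb_def by (rule ext) (rule tvec_of_expand[OF assms(1) c, symmetric])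
  then show "tangent_basis A p (\<lambda>i. tvec_of A p (chart_at A p) (axis i 1))"
    using bij_betw_tvec_of[OF assms(1) c] unfolding tangent_basis_iff by (simp only:)
qed

text \<open>\<open>\<Phi>\<close> is linear on the tangent space only, so the induction over partial
  sums has to keep every summand and every sum inside it.\<close>

lemma tangent_iso_lincomb:
  assumes A: "smooth_atlas M A" and p: "p \<in> topspace M"
    and \<Phi>: "tangent_iso A p q \<Phi>" and \<xi>: "\<And>i. \<xi> i \<in> tangent_space A p"
  shows "\<Phi> (lincomb \<xi> a) = lincomb (\<lambda>i. \<Phi> (\<xi> i)) a"
proof -
  note T = subspace_tangent_space[OF A p]
  have "\<Phi> (\<Sum>i\<in>I. (a $ i) *\<^sub>R \<xi> i) = (\<Sum>i\<in>I. (a $ i) *\<^sub>R \<Phi> (\<xi> i))" for I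
  proof (induction I rule: infinite_finite_induct)
    case (insert i I)
    have "(\<Sum>i\<in>I. (a $ i) *\<^sub>R \<xi> i) \<in> tangent_space A p" "(a $ i) *\<^sub>R \<xi> i \<in> tangent_space A p"
      using \<xi> by (auto intro!: subspace_sum[OF T] subspace_scale[OF T])
    then have "\<Phi> ((a $ i) *\<^sub>R \<xi> i + (\<Sum>i\<in>I. (a $ i) *\<^sub>R \<xi> i))
        = \<Phi> ((a $ i) *\<^sub>R \<xi> i) + \<Phi> (\<Sum>i\<in>I. (a $ i) *\<^sub>R \<xi> i)"
      and "\<Phi> ((a $ i) *\<^sub>R \<xi> i) = (a $ i) *\<^sub>R \<Phi> (\<xi> i)"
      using \<Phi> \<xi> unfolding tangent_iso_def by blast+
    then show ?case
      unfolding sum.insert[OF insert.hyps] insert.IH by (simp only:)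
  next
    case empty
    have "\<Phi> (0 *\<^sub>R 0) = 0 *\<^sub>R \<Phi> 0"
      using \<Phi> subspace_0[OF T] unfolding tangent_iso_def by blast
    then show ?case unfolding sum.empty scaleR_zero_left .
  qed simp
  then show ?thesis by (simp add: lincomb_def)
qed

lemma tangent_basis_image:
  assumes A: "smooth_atlas M A" and p: "p \<in> topspace M"
    and \<Phi>: "tangent_iso A p q \<Phi>" and \<xi>: "tangent_basis A p \<xi>"
  shows "tangent_basis A q (\<lambda>i. \<Phi> (\<xi> i))"
proof -
  have "lincomb (\<lambda>i. \<Phi> (\<xi> i)) = \<Phi> \<circ> lincomb \<xi>"
    by (rule ext) (simp only: comp_apply
        tangent_iso_lincomb[OF A p \<Phi> tangent_basis_in_tangent_space[OF \<xi>]])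
  moreover have "bij_betw \<Phi> (tangent_space A p) (tangent_space A q)"
    using \<Phi> by (simp only: tangent_iso_def)
  ultimately show ?thesis
    using \<xi> unfolding tangent_basis_iff by (simp only: bij_betw_trans)
qed

text \<open>Read off coordinates in \<open>\<xi>\<close> and reuse them in \<open>\<eta>\<close>.
  This supplies the candidate isometry when two bases have the same constants.\<close>

lemma tangent_iso_between_bases:
  assumes "tangent_basis A p \<xi>" "tangent_basis A q \<eta>"
  obtains \<Phi> where "tangent_iso A p q \<Phi>" "\<And>a. \<Phi> (lincomb \<xi> a) = lincomb \<eta> a"
proof -
  define \<Phi> where "\<Phi> = lincomb \<eta> \<circ> inv_into UNIV (lincomb \<xi>)"
  have \<xi>: "bij_betw (lincomb \<xi>) UNIV (tangent_space A p)"
    and \<eta>: "bij_betw (lincomb \<eta>) UNIV (tangent_space A q)"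
    using assms by (auto simp: tangent_basis_iff)
  have eq: "\<Phi> (lincomb \<xi> a) = lincomb \<eta> a" for a
    using \<xi> by (simp add: \<Phi>_def bij_betw_def)
  have "tangent_iso A p q \<Phi>"
    unfolding tangent_iso_def
  proof (intro conjI ballI allI)
    show "bij_betw \<Phi> (tangent_space A p) (tangent_space A q)"
      unfolding \<Phi>_def by (rule bij_betw_trans[OF bij_betw_inv_into[OF \<xi>] \<eta>])
  next
    fix x y assume "x \<in> tangent_space A p" "y \<in> tangent_space A p"
    then obtain a b where "x = lincomb \<xi> a" "y = lincomb \<xi> b"
      using \<xi> unfolding bij_betw_def by blast
    then show "\<Phi> (x + y) = \<Phi> x + \<Phi> y"
      by (simp add: eq flip: linear_add[OF linear_lincomb])
  next
    fix r x assume "x \<in> tangent_space A p"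
    then obtain a where "x = lincomb \<xi> a"
      using \<xi> by (auto simp: bij_betw_def)
    then show "\<Phi> (r *\<^sub>R x) = r *\<^sub>R \<Phi> x"
      by (simp add: eq flip: linear_scale[OF linear_lincomb])
  qed
  with eq that show ?thesis by blast
qed

section \<open>Scaling and multilinear expansion\<close>

lemma tangent_iso_in_tangent_space:
  "tangent_iso A p q \<Phi> \<Longrightarrow> x \<in> tangent_space A p \<Longrightarrow> \<Phi> x \<in> tangent_space A q"
  unfolding tangent_iso_def bij_betw_def by blast

lemma tangent_iso_scale:
  assumes A: "smooth_atlas M A" and q: "q \<in> topspace M"
    and \<Phi>: "tangent_iso A p q \<Phi>" and r: "r \<noteq> 0"
  shows "tangent_iso A p q (\<lambda>x. r *\<^sub>R \<Phi> x)"
proof -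
  have "bij_betw (\<lambda>x. r *\<^sub>R x) (tangent_space A q) (tangent_space A q)"
    using r by (intro bij_betw_byWitness[where f' = "\<lambda>x. (1/r) *\<^sub>R x"])
      (auto intro: subspace_scale[OF subspace_tangent_space[OF A q]])
  then have "bij_betw ((\<lambda>x. r *\<^sub>R x) \<circ> \<Phi>) (tangent_space A p) (tangent_space A q)"
    using \<Phi> unfolding tangent_iso_def by (blast intro: bij_betw_trans)
  then show ?thesis
    unfolding tangent_iso_def
  proof (intro conjI ballI allI)
    fix x y assume "x \<in> tangent_space A p" "y \<in> tangent_space A p"
    then have "\<Phi> (x + y) = \<Phi> x + \<Phi> y"
      using \<Phi> unfolding tangent_iso_def by blast
    then show "r *\<^sub>R \<Phi> (x + y) = r *\<^sub>R \<Phi> x + r *\<^sub>R \<Phi> y"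
      by (simp only: scaleR_add_right)
  next
    fix a x assume "x \<in> tangent_space A p"
    then have "\<Phi> (a *\<^sub>R x) = a *\<^sub>R \<Phi> x"
      using \<Phi> unfolding tangent_iso_def by blast
    then show "r *\<^sub>R \<Phi> (a *\<^sub>R x) = a *\<^sub>R r *\<^sub>R \<Phi> x"
      by (simp only: scaleR_left_commute)
  qed (simp only: comp_def)
qed

lemma nabla_R_scale:
  assumes "length xs = d + 4"
  shows "nabla_R A g d p (map (\<lambda>x. r *\<^sub>R \<Phi> x) xs) = r ^ (d + 4) * nabla_R A g d p (map \<Phi> xs)"
proof -
  have "(\<Prod>n<d + 4. (map (\<lambda>x. r *\<^sub>R \<Phi> x) xs ! n) c $ (js ! n))
      = r ^ (d + 4) * (\<Prod>n<d + 4. (map \<Phi> xs ! n) c $ (js ! n))" for js c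
  proof -
    have "(\<Prod>n<d + 4. (map (\<lambda>x. r *\<^sub>R \<Phi> x) xs ! n) c $ (js ! n))
      = (\<Prod>n<d + 4. r * (map \<Phi> xs ! n) c $ (js ! n))"
      using assms by (intro prod.cong) (auto simp: scaleR_fun_def)
    then show ?thesis by (simp add: prod.distrib)
  qed
  then show ?thesis
    unfolding nabla_R_def Let_def sum_distrib_left by (simp add: mult.left_commute)
qed

text \<open>Multilinearity: the product of coordinates in \<open>nabla_R\<close> distributes over
  the linear combinations, so the values on tuples from \<open>\<xi>\<close> determine the tensor on
  their span.\<close>

lemma nabla_R_lincomb:
  fixes A :: "('a, real^'m::finite) chart set" and \<xi> :: "'i::finite \<Rightarrow> ('a, real^'m) tvec"
  assumes "\<And>n. n < d + 4 \<Longrightarrow> xs ! n = lincomb \<xi> (\<alpha> n)"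
  shows "nabla_R A g d p xs
    = (\<Sum>is\<in>{is. length is = d + 4}. nabla_R A g d p (map \<xi> is) * (\<Prod>n<d + 4. \<alpha> n $ (is ! n)))"
proof -
  define c where "c = chart_at A p"
  define F where "F js = (cov_deriv (metric_coords A g c) ^^ d) (curv_comps (metric_coords A g c)) js (snd c p)" for js
  have sumc: "(\<Sum>i\<in>I. f i) c = (\<Sum>i\<in>I. f i c)" for f :: "'i \<Rightarrow> ('a, real^'m) tvec" and I
    by (induction I rule: infinite_finite_induct) auto
  have co: "lincomb \<xi> a c $ k = (\<Sum>i\<in>UNIV. a $ i * \<xi> i c $ k)" for a k
    unfolding lincomb_def sumc by (simp add: scaleR_fun_def)
  have "(\<Prod>n<d + 4. (xs ! n) c $ (js ! n))
      = (\<Sum>is\<in>{is. length is = d + 4}. (\<Prod>n<d + 4. (map \<xi> is ! n) c $ (js ! n)) * (\<Prod>n<d + 4. \<alpha> n $ (is ! n)))"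
    for js
  proof -
    have "(\<Prod>n<d + 4. (xs ! n) c $ (js ! n)) = (\<Prod>n<d + 4. \<Sum>i\<in>UNIV. \<alpha> n $ i * \<xi> i c $ (js ! n))"
      using assms by (simp add: co)
    also have "\<dots> = (\<Sum>is\<in>{is. length is = d + 4}. \<Prod>n<d + 4. \<alpha> n $ (is ! n) * \<xi> (is ! n) c $ (js ! n))"
      by (rule prod_sum_lists)
    also have "\<dots> = (\<Sum>is\<in>{is. length is = d + 4}.
        (\<Prod>n<d + 4. (map \<xi> is ! n) c $ (js ! n)) * (\<Prod>n<d + 4. \<alpha> n $ (is ! n)))"
      by (intro sum.cong refl) (simp add: prod.distrib mult.commute)
    finally show ?thesis .
  qed
  note expand = this
  show ?thesis
    unfolding nabla_R_def Let_def c_def[symmetric] F_def[symmetric] expand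
      sum_distrib_left sum_distrib_right
    by (subst sum.swap) (simp only: mult.assoc)
qed

section \<open>Equivalence of the three conditions\<close>

text \<open>The \<open>d + 4\<close> slots and the weight \<open>- d - 2\<close> together leave
  exponent 2, the factor of the homothety.\<close>

lemma powi_minus_mult_power:
  fixes \<mu> :: real
  assumes "\<mu> \<noteq> 0"
  shows "\<mu> powi (- int d - 2) * \<mu> ^ (d + 4) = \<mu>\<^sup>2"
proof -
  have "\<mu> powi (- int d - 2) * \<mu> powi int (d + 4) = \<mu> powi (- int d - 2 + int (d + 4))"
    by (rule power_int_add[symmetric]) (simp add: assms)
  also have "- int d - 2 + int (d + 4) = int 2" by simp
  finally show ?thesis by (simp only: power_int_of_nat)
qed

lemma list_length_add4:
  assumes "length xs = d + 4"
  obtains x1 x2 x3 x4 ys where "xs = x1 # x2 # x3 # x4 # ys" "length ys = d"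
proof -
  have "length xs = Suc (Suc (Suc (Suc d)))" using assms by simp
  with that show ?thesis by (auto simp only: length_Suc_conv)
qed

lemma list_length_add2:
  assumes "length xs = d + 2"
  obtains x1 x2 ys where "xs = x1 # x2 # ys" "length ys = d"
proof -
  have "length xs = Suc (Suc d)" using assms by simp
  with that show ?thesis by (auto simp only: length_Suc_conv)
qed

lemma isometry_of_homothety:
  assumes A: "smooth_atlas M A" and g: "pseudo_riemannian_metric M A g"
    and P: "P \<in> topspace M" and Q: "Q \<in> topspace M"
    and \<Phi>: "linear_homothety A g P Q \<Phi>"
    and curv: "\<And>d xs z. d \<le> k \<Longrightarrow> length xs = d + 2 \<Longrightarrow> set xs \<subseteq> tangent_space A P
      \<Longrightarrow> z \<in> tangent_space A P
      \<Longrightarrow> \<Phi> (nabla_curv_op A g d P xs z) = nabla_curv_op A g d Q (map \<Phi> xs) (\<Phi> z)"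
  shows "\<exists>\<phi> \<mu>. linear_isometry A g P Q \<phi> \<and> \<mu> \<noteq> 0 \<and>
    (\<forall>d\<le>k. \<forall>xs. length xs = d + 4 \<and> set xs \<subseteq> tangent_space A P \<longrightarrow>
       nabla_R A g d Q (map \<phi> xs) = \<mu> powi (- int d - 2) * nabla_R A g d P xs)"
proof -
  obtain \<mu> where iso: "tangent_iso A P Q \<Phi>" and \<mu>: "\<mu> \<noteq> 0"
    and hom: "\<And>x y. x \<in> tangent_space A P \<Longrightarrow> y \<in> tangent_space A P \<Longrightarrow> g Q (\<Phi> x) (\<Phi> y) = \<mu>\<^sup>2 * g P x y"
    using \<Phi> unfolding linear_homothety_def by blast
  define \<phi> where "\<phi> x = (1 / \<mu>) *\<^sub>R \<Phi> x" for x
  note in_Q = tangent_iso_in_tangent_space[OF iso]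
  have "g Q (\<phi> x) (\<phi> y) = g P x y" if "x \<in> tangent_space A P" "y \<in> tangent_space A P" for x y
  proof -
    have "\<phi> y \<in> tangent_space A Q"
      unfolding \<phi>_def using that by (intro subspace_scale subspace_tangent_space[OF A Q] in_Q)
    then have "g Q (\<phi> x) (\<phi> y) = 1 / \<mu> * (1 / \<mu> * (\<mu>\<^sup>2 * g P x y))"
      unfolding \<phi>_def using that in_Q
      by (simp only: metric_scale_left[OF g Q] metric_scale_right[OF A g Q] hom)
    then show ?thesis using \<mu> by (simp add: power2_eq_square)
  qed
  moreover have "tangent_iso A P Q \<phi>"
    unfolding \<phi>_def using \<mu> by (intro tangent_iso_scale[OF A Q iso]) simp
  ultimately have "linear_isometry A g P Q \<phi>"
    unfolding linear_isometry_def by blast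
  moreover have "nabla_R A g d Q (map \<phi> xs) = \<mu> powi (- int d - 2) * nabla_R A g d P xs"
    if d: "d \<le> k" and len: "length xs = d + 4" and xs: "set xs \<subseteq> tangent_space A P" for d xs
  proof -
    obtain x1 x2 x3 x4 ys where eq: "xs = x1 # x2 # x3 # x4 # ys" "length ys = d"
      using list_length_add4[OF len] .
    have T: "x3 \<in> tangent_space A P" "x4 \<in> tangent_space A P" "set (x1 # x2 # ys) \<subseteq> tangent_space A P"
      using xs eq by auto
    have len2: "length (x1 # x2 # ys) = d + 2"
      using eq by simp
    have map_eq: "map \<Phi> xs = \<Phi> x1 # \<Phi> x2 # \<Phi> x3 # \<Phi> x4 # map \<Phi> ys" "length (map \<Phi> ys) = d"
      using eq by simp_all
    have "nabla_R A g d Q (map \<Phi> xs)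
        = g Q (nabla_curv_op A g d Q (map \<Phi> (x1 # x2 # ys)) (\<Phi> x3)) (\<Phi> x4)"
      using nabla_R_eq_metric[OF A g Q map_eq in_Q[OF T(2)]] by (simp only: list.map)
    also have "\<dots> = g Q (\<Phi> (nabla_curv_op A g d P (x1 # x2 # ys) x3)) (\<Phi> x4)"
      by (simp only: curv[OF d len2 T(3,1)])
    \<comment> \<open>The homothety relation is applied to the curvature vector and
      \<open>x4\<close>, both tangent at \<open>P\<close>.\<close>
    also have "\<dots> = \<mu>\<^sup>2 * nabla_R A g d P xs"
      using hom[OF nabla_curv_op_in_tangent_space[OF A P] T(2)] nabla_R_eq_metric[OF A g P eq T(2)]
      by (simp only:)
    finally have "nabla_R A g d Q (map \<phi> xs) = (1 / \<mu>) ^ (d + 4) * (\<mu>\<^sup>2 * nabla_R A g d P xs)"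
      unfolding \<phi>_def by (simp only: nabla_R_scale[OF len])
    also have "\<dots> = \<mu> powi (- int d - 2) * nabla_R A g d P xs"
      \<comment> \<open>The square is split into the weight and \<open>\<mu> ^ (d + 4)\<close>; the
        latter cancels the factor from the slots.\<close>
      using \<mu> unfolding powi_minus_mult_power[OF \<mu>, of d, symmetric] by (simp add: power_one_over)
    finally show ?thesis .
  qed
  ultimately show ?thesis using \<mu> by blast
qed

text \<open>Nondegeneracy recovers the operator: both sides have equal products with every tangent
  vector at \<open>Q\<close>, and these products are values of \<open>nabla_R\<close>.\<close>

lemma homothety_of_isometry:
  assumes A: "smooth_atlas M A" and g: "pseudo_riemannian_metric M A g"
    and P: "P \<in> topspace M" and Q: "Q \<in> topspace M"
    and \<phi>: "linear_isometry A g P Q \<phi>" and \<mu>: "\<mu> \<noteq> 0"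
    and curv: "\<And>d xs. d \<le> k \<Longrightarrow> length xs = d + 4 \<Longrightarrow> set xs \<subseteq> tangent_space A P
      \<Longrightarrow> nabla_R A g d Q (map \<phi> xs) = \<mu> powi (- int d - 2) * nabla_R A g d P xs"
  shows "\<exists>\<Phi>. linear_homothety A g P Q \<Phi> \<and>
    (\<forall>d\<le>k. \<forall>xs z. length xs = d + 2 \<and> set xs \<subseteq> tangent_space A P \<and> z \<in> tangent_space A P \<longrightarrow>
       \<Phi> (nabla_curv_op A g d P xs z) = nabla_curv_op A g d Q (map \<Phi> xs) (\<Phi> z))"
proof -
  define \<Phi> where "\<Phi> x = \<mu> *\<^sub>R \<phi> x" for x
  have iso\<phi>: "tangent_iso A P Q \<phi>"
    and isom: "\<And>x y. x \<in> tangent_space A P \<Longrightarrow> y \<in> tangent_space A P \<Longrightarrow> g Q (\<phi> x) (\<phi> y) = g P x y"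
    using \<phi> unfolding linear_isometry_def by blast+
  have iso: "tangent_iso A P Q \<Phi>"
    unfolding \<Phi>_def by (rule tangent_iso_scale[OF A Q iso\<phi> \<mu>])
  note in_Q = tangent_iso_in_tangent_space[OF iso]
  have hom: "g Q (\<Phi> x) (\<Phi> y) = \<mu>\<^sup>2 * g P x y"
    if "x \<in> tangent_space A P" "y \<in> tangent_space A P" for x y
  proof -
    have "g Q (\<Phi> x) (\<Phi> y) = \<mu> * (\<mu> * g P x y)"
      using that in_Q[OF that(2)] tangent_iso_in_tangent_space[OF iso\<phi>] unfolding \<Phi>_def
      by (simp only: metric_scale_left[OF g Q] metric_scale_right[OF A g Q] isom)
    then show ?thesis by (simp add: power2_eq_square)
  qed
  have "\<Phi> (nabla_curv_op A g d P xs z) = nabla_curv_op A g d Q (map \<Phi> xs) (\<Phi> z)"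
    if d: "d \<le> k" and len: "length xs = d + 2" and xs: "set xs \<subseteq> tangent_space A P"
      and z: "z \<in> tangent_space A P" for d xs z
  proof -
    let ?u = "\<Phi> (nabla_curv_op A g d P xs z)" and ?v = "nabla_curv_op A g d Q (map \<Phi> xs) (\<Phi> z)"
    obtain x1 x2 ys where eq: "xs = x1 # x2 # ys" "length ys = d"
      using list_length_add2[OF len] .
    note T = subspace_tangent_space[OF A Q]
    have u: "?u \<in> tangent_space A Q" and v: "?v \<in> tangent_space A Q"
      using in_Q nabla_curv_op_in_tangent_space[OF A P] nabla_curv_op_in_tangent_space[OF A Q]
      by blast+
    have "g Q (?u - ?v) y = 0" if y: "y \<in> tangent_space A Q" for y
    proof -
      \<comment> \<open>Surjectivity of \<open>\<Phi>\<close> makes the test vector an image; its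
        preimage \<open>w\<close> fills the fourth slot of the curvature tensor at
        \<open>P\<close>.\<close>
      obtain w where w: "w \<in> tangent_space A P" "y = \<Phi> w"
        using iso y unfolding tangent_iso_def bij_betw_def by blast
      let ?l = "x1 # x2 # z # w # ys"
      have l: "length ?l = d + 4" "set ?l \<subseteq> tangent_space A P"
        using eq xs z w by auto
      have map_eq: "map \<Phi> ?l = \<Phi> x1 # \<Phi> x2 # \<Phi> z # \<Phi> w # map \<Phi> ys" "length (map \<Phi> ys) = d"
        using eq by simp_all
      have "g Q ?v y = nabla_R A g d Q (map \<Phi> ?l)"
        using nabla_R_eq_metric[OF A g Q map_eq in_Q[OF w(1)]] w eq by (simp only: list.map)
      also have "\<dots> = \<mu> ^ (d + 4) * (\<mu> powi (- int d - 2) * nabla_R A g d P ?l)"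
        unfolding \<Phi>_def nabla_R_scale[OF l(1)] curv[OF d l] ..
      also have "\<dots> = \<mu>\<^sup>2 * nabla_R A g d P ?l"
        unfolding powi_minus_mult_power[OF \<mu>, of d, symmetric] by (simp only: ac_simps)
      also have "\<dots> = \<mu>\<^sup>2 * g P (nabla_curv_op A g d P xs z) w"
        using nabla_R_eq_metric[OF A g P refl eq(2) w(1)] eq by (simp only:)
      also have "\<dots> = g Q ?u y"
        using hom[OF nabla_curv_op_in_tangent_space[OF A P] w(1)] w by (simp only:)
      finally have "g Q ?v y = g Q ?u y" .
      \<comment> \<open>Additivity on the left replaces a subtraction rule for the metric.\<close>
      moreover have "g Q (?u - ?v + ?v) y = g Q (?u - ?v) y + g Q ?v y"
        using u v y by (intro metric_add_left[OF g Q] subspace_diff[OF T])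
      ultimately show ?thesis by (simp only: diff_add_cancel)
    qed
    then have "?u - ?v = 0"
      using metric_nondegenerate[OF g Q subspace_diff[OF T u v]] by blast
    then show ?thesis by (simp only: right_minus_eq)
  qed
  moreover have "linear_homothety A g P Q \<Phi>"
    unfolding linear_homothety_def using iso hom \<mu> by blast
  ultimately show ?thesis by blast
qed

lemma homothety_condition_iff_isometry_condition:
  assumes A: "smooth_atlas M A" and g: "pseudo_riemannian_metric M A g"
  shows "homothety_condition M A g k \<longleftrightarrow> isometry_condition M A g k"
proof
  assume L: "homothety_condition M A g k"
  show "isometry_condition M A g k"
    unfolding isometry_condition_def
  proof (intro ballI)
    fix P Q assume P: "P \<in> topspace M" and Q: "Q \<in> topspace M"
    with L obtain \<Phi> where \<Phi>: "linear_homothety A g P Q \<Phi>"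
      and c: "\<forall>d\<le>k. \<forall>xs z. length xs = d + 2 \<and> set xs \<subseteq> tangent_space A P \<and> z \<in> tangent_space A P \<longrightarrow>
           \<Phi> (nabla_curv_op A g d P xs z) = nabla_curv_op A g d Q (map \<Phi> xs) (\<Phi> z)"
      unfolding homothety_condition_def by blast
    show "\<exists>\<phi> \<mu>. linear_isometry A g P Q \<phi> \<and> \<mu> \<noteq> 0 \<and>
        (\<forall>d\<le>k. \<forall>xs. length xs = d + 4 \<and> set xs \<subseteq> tangent_space A P \<longrightarrow>
           nabla_R A g d Q (map \<phi> xs) = \<mu> powi (- int d - 2) * nabla_R A g d P xs)"
      by (rule isometry_of_homothety[OF A g P Q \<Phi>]) (use c in blast)
  qed
next
  assume R: "isometry_condition M A g k"
  show "homothety_condition M A g k"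
    unfolding homothety_condition_def
  proof (intro ballI)
    fix P Q assume P: "P \<in> topspace M" and Q: "Q \<in> topspace M"
    with R obtain \<phi> \<mu> where \<phi>: "linear_isometry A g P Q \<phi>" and \<mu>: "\<mu> \<noteq> 0"
      and c: "\<forall>d\<le>k. \<forall>xs. length xs = d + 4 \<and> set xs \<subseteq> tangent_space A P \<longrightarrow>
           nabla_R A g d Q (map \<phi> xs) = \<mu> powi (- int d - 2) * nabla_R A g d P xs"
      unfolding isometry_condition_def by blast
    show "\<exists>\<Phi>. linear_homothety A g P Q \<Phi> \<and>
        (\<forall>d\<le>k. \<forall>xs z. length xs = d + 2 \<and> set xs \<subseteq> tangent_space A P \<and> z \<in> tangent_space A P \<longrightarrow>
           \<Phi> (nabla_curv_op A g d P xs z) = nabla_curv_op A g d Q (map \<Phi> xs) (\<Phi> z))"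
      by (rule homothety_of_isometry[OF A g P Q \<phi> \<mu>]) (use c in blast)
  qed
qed

text \<open>The map carrying \<open>\<xi>\<close> to \<open>\<eta>\<close> preserves the common Gram
  matrix. The components at the two points are \<open>c\<close> weighted by powers of
  \<open>\<mu>\<close> and \<open>\<nu>\<close>, so the required scale is
  \<open>\<nu> / \<mu>\<close>.\<close>

lemma isometry_of_bases:
  assumes A: "smooth_atlas M A" and g: "pseudo_riemannian_metric M A g"
    and P: "P \<in> topspace M" and Q: "Q \<in> topspace M"
    and \<xi>: "tangent_basis A P \<xi>" and \<eta>: "tangent_basis A Q \<eta>"
    and \<mu>: "\<mu> \<noteq> 0" and \<nu>: "\<nu> \<noteq> 0"
    and metric: "\<And>i j. g P (\<xi> i) (\<xi> j) = g Q (\<eta> i) (\<eta> j)"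
    and R\<xi>: "\<And>d js. d \<le> k \<Longrightarrow> length js = d + 4 \<Longrightarrow>
      nabla_R A g d P (map \<xi> js) = \<mu> powi (- int d - 2) * c js"
    and R\<eta>: "\<And>d js. d \<le> k \<Longrightarrow> length js = d + 4 \<Longrightarrow>
      nabla_R A g d Q (map \<eta> js) = \<nu> powi (- int d - 2) * c js"
  shows "\<exists>\<phi> r. linear_isometry A g P Q \<phi> \<and> r \<noteq> 0 \<and>
    (\<forall>d\<le>k. \<forall>xs. length xs = d + 4 \<and> set xs \<subseteq> tangent_space A P \<longrightarrow>
       nabla_R A g d Q (map \<phi> xs) = r powi (- int d - 2) * nabla_R A g d P xs)"
proof -
  obtain \<phi> where iso: "tangent_iso A P Q \<phi>" and \<phi>: "\<And>a. \<phi> (lincomb \<xi> a) = lincomb \<eta> a"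
    using tangent_iso_between_bases[OF \<xi> \<eta>] by blast
  have coords: "\<exists>a. x = lincomb \<xi> a" if "x \<in> tangent_space A P" for x
    using \<xi> that unfolding tangent_basis_iff bij_betw_def by blast
  have "g Q (\<phi> x) (\<phi> y) = g P x y" if xy: "x \<in> tangent_space A P" "y \<in> tangent_space A P" for x y
  proof -
    obtain a b where "x = lincomb \<xi> a" "y = lincomb \<xi> b"
      using coords xy by blast
    then show ?thesis
      \<comment> \<open>\<open>\<phi>\<close> has to be evaluated while \<open>lincomb\<close> is
        still folded; afterwards both metrics are expanded over the bases.\<close>
      by (simp only: \<phi>)
        (simp only: lincomb_def metric metric_sum_sum[OF A g P] metric_sum_sum[OF A g Q]
          tangent_basis_in_tangent_space[OF \<xi>] tangent_basis_in_tangent_space[OF \<eta>])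
  qed
  with iso have "linear_isometry A g P Q \<phi>"
    unfolding linear_isometry_def by blast
  moreover have "nabla_R A g d Q (map \<phi> xs) = (\<nu> / \<mu>) powi (- int d - 2) * nabla_R A g d P xs"
    if d: "d \<le> k" and len: "length xs = d + 4" and xs: "set xs \<subseteq> tangent_space A P" for d xs
  proof -
    have "\<exists>a. xs ! n = lincomb \<xi> a" if "n < d + 4" for n
      using that len xs by (intro coords) (simp add: subset_iff)
    then obtain \<alpha> where \<alpha>: "\<And>n. n < d + 4 \<Longrightarrow> xs ! n = lincomb \<xi> (\<alpha> n)"
      by metis
    have \<alpha>': "map \<phi> xs ! n = lincomb \<eta> (\<alpha> n)" if "n < d + 4" for n
      using \<alpha>[OF that] that len by (simp add: \<phi>)
    \<comment> \<open>The unweighted contraction of \<open>c\<close>, shared by both points because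
      \<open>\<phi>\<close> preserves the coefficients \<open>\<alpha>\<close>.\<close>
    define s where "s = (\<Sum>js\<in>{js. length js = d + 4}. c js * (\<Prod>n<d + 4. \<alpha> n $ (js ! n)))"
    have "nabla_R A g d P xs = (\<Sum>js\<in>{js. length js = d + 4}.
        nabla_R A g d P (map \<xi> js) * (\<Prod>n<d + 4. \<alpha> n $ (js ! n)))"
      by (rule nabla_R_lincomb) (rule \<alpha>)
    also have "\<dots> = \<mu> powi (- int d - 2) * s"
      unfolding s_def sum_distrib_left
      by (intro sum.cong refl) (simp only: mem_Collect_eq R\<xi>[OF d] mult.assoc)
    finally have P_eq: "nabla_R A g d P xs = \<mu> powi (- int d - 2) * s" .
    have "nabla_R A g d Q (map \<phi> xs) = (\<Sum>js\<in>{js. length js = d + 4}.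
        nabla_R A g d Q (map \<eta> js) * (\<Prod>n<d + 4. \<alpha> n $ (js ! n)))"
      by (rule nabla_R_lincomb) (rule \<alpha>')
    also have "\<dots> = \<nu> powi (- int d - 2) * s"
      unfolding s_def sum_distrib_left
      by (intro sum.cong refl) (simp only: mem_Collect_eq R\<eta>[OF d] mult.assoc)
    finally show ?thesis
      using \<mu> by (simp add: P_eq power_int_divide_distrib)
  qed
  moreover have "\<nu> / \<mu> \<noteq> 0" using \<mu> \<nu> by simp
  ultimately show ?thesis by blast
qed

text \<open>Forward, a basis at one fixed point provides the constants, and the isometries from that
  point transport it everywhere. Backward, any two points are compared through
  \<open>isometry_of_bases\<close>.\<close>

lemma isometry_condition_iff_basis_condition:
  assumes A: "smooth_atlas M A" and g: "pseudo_riemannian_metric M A g"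
  shows "isometry_condition M A g k \<longleftrightarrow> basis_condition M A g k"
proof
  assume L: "isometry_condition M A g k"
  show "basis_condition M A g k"
  \<comment> \<open>The constants are read off at a point, so the empty space, where the basis
    condition is vacuous, is set aside.\<close>
  proof (cases "topspace M = {}")
    case True
    then show ?thesis by (simp add: basis_condition_def)
  next
    case False
    then obtain P where P: "P \<in> topspace M" by blast
    obtain \<xi> where \<xi>: "tangent_basis A P \<xi>"
      using tangent_basis_exists[OF A P] by blast
    note \<xi>_in = tangent_basis_in_tangent_space[OF \<xi>]
    \<comment> \<open>The constants may depend on \<open>js\<close> alone, so the order is recovered
      as \<open>length js - 4\<close>.\<close>
    have "\<exists>\<eta> \<mu>. tangent_basis A Q \<eta> \<and> \<mu> \<noteq> 0 \<and> (\<forall>i j. g Q (\<eta> i) (\<eta> j) = g P (\<xi> i) (\<xi> j)) \<and>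
        (\<forall>d\<le>k. \<forall>js. length js = d + 4 \<longrightarrow> nabla_R A g d Q (map \<eta> js)
          = \<mu> powi (- int d - 2) * nabla_R A g (length js - 4) P (map \<xi> js))"
      if Q: "Q \<in> topspace M" for Q
    proof -
      obtain \<phi> \<mu> where \<phi>: "linear_isometry A g P Q \<phi>" and \<mu>: "\<mu> \<noteq> 0"
        and c: "\<forall>d\<le>k. \<forall>xs. length xs = d + 4 \<and> set xs \<subseteq> tangent_space A P \<longrightarrow>
             nabla_R A g d Q (map \<phi> xs) = \<mu> powi (- int d - 2) * nabla_R A g d P xs"
        using L P Q unfolding isometry_condition_def by blast
      have "nabla_R A g d Q (map (\<lambda>i. \<phi> (\<xi> i)) js)
          = \<mu> powi (- int d - 2) * nabla_R A g (length js - 4) P (map \<xi> js)"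
        if "d \<le> k" "length js = d + 4" for d js
      proof -
        have "set (map \<xi> js) \<subseteq> tangent_space A P"
          using \<xi>_in by auto
        then have "nabla_R A g d Q (map \<phi> (map \<xi> js))
            = \<mu> powi (- int d - 2) * nabla_R A g d P (map \<xi> js)"
          using c that(1) by (simp only: length_map that(2))
        then show ?thesis using that(2) by (simp add: comp_def)
      qed
      moreover have "g Q (\<phi> (\<xi> i)) (\<phi> (\<xi> j)) = g P (\<xi> i) (\<xi> j)" for i j
        using \<phi> \<xi>_in unfolding linear_isometry_def by blast
      moreover have "tangent_basis A Q (\<lambda>i. \<phi> (\<xi> i))"
        using \<phi> unfolding linear_isometry_def by (intro tangent_basis_image[OF A P _ \<xi>]) blast
      ultimately show ?thesis using \<mu> by blast
    qed
    then show ?thesis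
      unfolding basis_condition_def
      by (intro exI[of _ "\<lambda>i j. g P (\<xi> i) (\<xi> j)"]
          exI[of _ "\<lambda>js. nabla_R A g (length js - 4) P (map \<xi> js)"]) blast
  qed
next
  assume R: "basis_condition M A g k"
  then obtain \<epsilon> c where B: "\<And>Q. Q \<in> topspace M \<Longrightarrow> \<exists>\<xi>. \<exists>\<mu>::real. tangent_basis A Q \<xi> \<and> \<mu> \<noteq> 0 \<and>
      (\<forall>i j. g Q (\<xi> i) (\<xi> j) = \<epsilon> i j) \<and>
      (\<forall>d\<le>k. \<forall>js. length js = d + 4 \<longrightarrow> nabla_R A g d Q (map \<xi> js) = \<mu> powi (- int d - 2) * c js)"
    unfolding basis_condition_def by blast
  show "isometry_condition M A g k"
    unfolding isometry_condition_def
  proof (intro ballI)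
    fix P Q assume P: "P \<in> topspace M" and Q: "Q \<in> topspace M"
    obtain \<xi> \<mu> where \<xi>: "tangent_basis A P \<xi>" "\<mu> \<noteq> 0" "\<And>i j. g P (\<xi> i) (\<xi> j) = \<epsilon> i j"
      "\<And>d js. d \<le> k \<Longrightarrow> length js = d + 4 \<Longrightarrow>
        nabla_R A g d P (map \<xi> js) = \<mu> powi (- int d - 2) * c js"
      using B[OF P] by blast
    obtain \<eta> \<nu> where \<eta>: "tangent_basis A Q \<eta>" "\<nu> \<noteq> 0" "\<And>i j. g Q (\<eta> i) (\<eta> j) = \<epsilon> i j"
      "\<And>d js. d \<le> k \<Longrightarrow> length js = d + 4 \<Longrightarrow>
        nabla_R A g d Q (map \<eta> js) = \<nu> powi (- int d - 2) * c js"
      using B[OF Q] by blast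
    have "g P (\<xi> i) (\<xi> j) = g Q (\<eta> i) (\<eta> j)" for i j
      by (simp only: \<xi>(3) \<eta>(3))
    from isometry_of_bases[OF A g P Q \<xi>(1) \<eta>(1) \<xi>(2) \<eta>(2) this \<xi>(4) \<eta>(4)]
    show "\<exists>\<phi> \<mu>. linear_isometry A g P Q \<phi> \<and> \<mu> \<noteq> 0 \<and>
        (\<forall>d\<le>k. \<forall>xs. length xs = d + 4 \<and> set xs \<subseteq> tangent_space A P \<longrightarrow>
           nabla_R A g d Q (map \<phi> xs) = \<mu> powi (- int d - 2) * nabla_R A g d P xs)"
      by blast
  qed
qed

theorem lemma1p2:
  fixes M :: "'a topology"
    and A :: "('a, real^'m::finite) chart set"
    and g :: "('a, real^'m) metric_field"
    and k :: nat
  assumes "pseudo_riemannian_manifold M A g"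
    and "CARD('m) \<ge> 2"
  shows "(homothety_condition M A g k \<longleftrightarrow> isometry_condition M A g k) \<and>
         (isometry_condition M A g k \<longleftrightarrow> basis_condition M A g k)"
proof -
  have "smooth_atlas M A" "pseudo_riemannian_metric M A g"
    using assms(1) by (auto simp: pseudo_riemannian_manifold_def smooth_manifold_def)
  then show ?thesis
    using homothety_condition_iff_isometry_condition isometry_condition_iff_basis_condition by blast
qed

end
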